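(* Let $p\ge 1$ be an integer, $\gamma,\delta>\frac{p-1}{2}$, and let $M\sim J\beta E_p(\gamma,\delta)$. Let $M^{[j]}$ denote the $j\times j$ upper left subblock of $M$. There exist independent random variables $p_{0,1},\dots,p_{p-1,1}$ and $p_{1,2},\dots,p_{p-1,2}$ with $$p_{i,1}\sim\beta(\gamma-i/2,\delta),\quad i=0,\dots,p-1,\qquad p_{i,2}\sim\beta(\delta-i/2,i/2),\quad i=1,\dots,p-1,$$ such that for all real $a,b$ the identity $$\log\Big((\det M^{[j]})^a(\det(I_j-M^{[j]}))^b\Big)=\log\big(p_{0,1}^a(1-p_{0,1})^b\big)+\sum_{i=1}^{j-1}\Big\{\log\big(p_{i,1}^a(1-p_{i,1})^b\big)+\log\big(p_{i,2}^b\big)\Big\}$$ holds for all $1\le j\le p$ simultaneously. In particular $\det M=\prod_{i=0}^{p-1}p_{i,1}$.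
   Context: $I_p$ is the $p\times p$ identity matrix and $0_p$ the zero matrix; for symmetric matrices $A<B$ means that $B-A$ is positive definite. Real symmetric $p\times p$ matrices $(m_{ij})$ are identified with the vector of entries $m_{ij}$, $1\le i\le j\le p$, in $\mathbb{R}^{p(p+1)/2}$, and densities are with respect to Lebesgue measure there. For $\gamma,\delta>\frac{p-1}{2}$, $J\beta E_p(\gamma,\delta)$ (real case, $\beta=1$) denotes the distribution on real symmetric $p\times p$ matrices with density proportional to $$(\det U)^{\gamma-\frac{p+1}{2}}\,(\det(I_p-U))^{\delta-\frac{p+1}{2}}\, I\{0_p<U<I_p\}.$$ $\beta(\gamma,\delta)$ denotes the Beta distribution on $[0,1]$ (density proportional to $x^{\gamma-1}(1-x)^{\delta-1}$). The identities are between random variables (on the event $0_p<M<I_p$, which has probability one). *)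

theory Defs
  imports
    "HOL-Probability.Probability"
    "Jordan_Normal_Form.Determinant"
    "Jordan_Normal_Form.DL_Submatrix"
begin

text \<open>
  Matrices are those of \<open>Jordan_Normal_Form\<close>, whose dimension is a number and not a type, so that
  all the upper left blocks of a matrix live in one type. Their indices start at 0.
\<close>

hide_const (open) Determinants.det

definition symmetric_mat :: "nat \<Rightarrow> real mat \<Rightarrow> bool" where
  "symmetric_mat p A \<longleftrightarrow> A \<in> carrier_mat p p \<and> transpose_mat A = A"

definition pos_def_mat :: "nat \<Rightarrow> real mat \<Rightarrow> bool" where
  "pos_def_mat p A \<longleftrightarrow> symmetric_mat p A \<and>
     (\<forall>x\<in>carrier_vec p. x \<noteq> 0\<^sub>v p \<longrightarrow> scalar_prod x (A *\<^sub>v x) > 0)"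

definition loewner_less :: "nat \<Rightarrow> real mat \<Rightarrow> real mat \<Rightarrow> bool" where
  "loewner_less p A B \<longleftrightarrow> pos_def_mat p (B - A)"

definition between_0_I :: "nat \<Rightarrow> real mat \<Rightarrow> bool" where
  "between_0_I p A \<longleftrightarrow> loewner_less p (0\<^sub>m p p) A \<and> loewner_less p A (1\<^sub>m p)"

definition upper_left :: "real mat \<Rightarrow> nat \<Rightarrow> real mat" where
  "upper_left A j = submatrix A {..<j} {..<j}"

text \<open>
  Symmetric \<open>p \<times> p\<close> matrices are identified with vectors indexed by the \<open>p (p + 1) / 2\<close> positions
  on and above the diagonal.
\<close>

definition upper_index :: "nat \<Rightarrow> (nat \<times> nat) set" where
  "upper_index p = {(i, j). i \<le> j \<and> j < p}"

definition upper_entries :: "nat \<Rightarrow> real mat \<Rightarrow> nat \<times> nat \<Rightarrow> real" where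
  "upper_entries p A = (\<lambda>ij\<in>upper_index p. A $$ ij)"

definition sym_mat_of :: "nat \<Rightarrow> (nat \<times> nat \<Rightarrow> real) \<Rightarrow> real mat" where
  "sym_mat_of p u = mat p p (\<lambda>(i, j). u (min i j, max i j))"

definition upper_lborel :: "nat \<Rightarrow> (nat \<times> nat \<Rightarrow> real) measure" where
  "upper_lborel p = (\<Pi>\<^sub>M ij\<in>upper_index p. lborel)"

definition JbetaE_kernel :: "nat \<Rightarrow> real \<Rightarrow> real \<Rightarrow> real mat \<Rightarrow> real" where
  "JbetaE_kernel p \<gamma> \<delta> U =
     (if between_0_I p U
      then det U powr (\<gamma> - (real p + 1) / 2) * det (1\<^sub>m p - U) powr (\<delta> - (real p + 1) / 2)
      else 0)"

definition JbetaE_distributed ::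
    "'a measure \<Rightarrow> nat \<Rightarrow> real \<Rightarrow> real \<Rightarrow> ('a \<Rightarrow> real mat) \<Rightarrow> bool" where
  "JbetaE_distributed N p \<gamma> \<delta> M \<longleftrightarrow>
     (\<forall>\<omega>\<in>space N. symmetric_mat p (M \<omega>)) \<and>
     (\<exists>c>0. distributed N (upper_lborel p) (\<lambda>\<omega>. upper_entries p (M \<omega>))
        (\<lambda>u. ennreal (c * JbetaE_kernel p \<gamma> \<delta> (sym_mat_of p u))))"

definition beta_density :: "real \<Rightarrow> real \<Rightarrow> real \<Rightarrow> real" where
  "beta_density \<gamma> \<delta> x =
     (if 0 \<le> x \<and> x \<le> 1 then x powr (\<gamma> - 1) * (1 - x) powr (\<delta> - 1) / Beta \<gamma> \<delta> else 0)"

definition beta_distributed :: "'a measure \<Rightarrow> real \<Rightarrow> real \<Rightarrow> ('a \<Rightarrow> real) \<Rightarrow> bool" where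
  "beta_distributed N \<gamma> \<delta> X \<longleftrightarrow> distributed N lborel X (\<lambda>x. ennreal (beta_density \<gamma> \<delta> x))"

end

theory Submission
  imports Defs
begin

text \<open>
  Write \<open>M\<close> of size \<open>n + 1\<close> as a block \<open>A\<close> bordered by a column \<open>v\<close> and a corner \<open>m\<close>. The Schur complement
  \<open>s = m - v\<^sup>T A\<inverse> v\<close> is the quotient \<open>det M / det A\<close>, and since
  \<open>Q = A\<inverse> + (I - A)\<inverse> = (A (I - A))\<inverse>\<close>, the corresponding quotient for \<open>I - M\<close> is \<open>1 - s - v\<^sup>T Q v\<close>.
  For fixed \<open>A\<close>, the change from \<open>m\<close> to \<open>s\<close> is a translation, and the image of Lebesgue measure under
  \<open>v \<mapsto> v\<^sup>T Q v\<close> has density proportional to \<open>det (A (I - A)) powr (1 / 2) * r powr (n / 2 - 1)\<close>. Substituting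
  \<open>r = (1 - s) (1 - q)\<close>, the density factors into the density of order \<open>n\<close> at \<open>A\<close> and two Beta
  densities at \<open>s\<close> and \<open>q\<close>, which gives the independence by induction on \<open>n\<close>.
\<close>

subsection \<open>Bordered matrices and leading minors\<close>

text \<open>No matrix square root and no Jacobian in several variables is used: completing the
  square reduces the form to a sum of squares one coordinate at a time, and the volume of balls
  gives the law of that sum. The exponents fit for the following reason. Order n + 1 puts the
  exponents \<gamma> - (n + 2) / 2 and \<delta> - (n + 2) / 2 on det A and det (I - A), and the
  factor with power 1 / 2 raises them to those of order n. The power of s is (\<gamma> - n / 2) - 1.
  The powers of 1 - s add up to \<delta> - 1: \<delta> - (n + 2) / 2 from 1 - s - r, n / 2 - 1 from
  the radial density and 1 from dr. What remains is q with exponent (\<delta> - n / 2) - 1 and 1 - q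
  with n / 2 - 1. The normalizing constant of the matrix density is never evaluated: the
  factorization holds for all product test functions with one and the same constant, which the
  constant functions 1 determine. The induction starts at order 1, because an empty column has no
  radial density; hence the variables q are indexed from 1.\<close>

definition qform :: "real mat \<Rightarrow> real vec \<Rightarrow> real" where
  "qform A x = scalar_prod x (A *\<^sub>v x)"

definition bordered :: "real mat \<Rightarrow> real vec \<Rightarrow> real \<Rightarrow> real mat" where
  "bordered A v m = four_block_mat A (mat (dim_vec v) 1 (\<lambda>(i, _). vec_index v i))
     (mat 1 (dim_vec v) (\<lambda>(_, j). vec_index v j)) (mat 1 1 (\<lambda>_. m))"

text \<open>Multiplying on the right by the unipotent block matrix with -z in its upper right corner
  clears the column v and leaves the Schur complement in the corner. A solution z of
  \<open>v = A *\<^sub>v z\<close> takes the place of an inverse of A.\<close>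

lemma det_bordered:
  assumes A: "A \<in> carrier_mat n n" and z: "z \<in> carrier_vec n" and v: "v = A *\<^sub>v z"
  shows "det (bordered A v m) = det A * (m - scalar_prod v z)"
proof -
  have vc: "v \<in> carrier_vec n" using A z v by auto
  define Z where "Z = mat n 1 (\<lambda>(i, _). - vec_index z i)"
  define V where "V = mat n 1 (\<lambda>(i, _). vec_index v i)"
  define W where "W = mat 1 n (\<lambda>(_, j). vec_index v j)"
  define D where "D = mat 1 1 (\<lambda>_. m)"
  define E where "E = mat 1 1 (\<lambda>_. m - scalar_prod v z)"
  have c: "Z \<in> carrier_mat n 1" "V \<in> carrier_mat n 1" "W \<in> carrier_mat 1 n"
    "D \<in> carrier_mat 1 1" "E \<in> carrier_mat 1 1" by (auto simp: Z_def V_def W_def D_def E_def)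
  have b: "bordered A v m = four_block_mat A V W D"
    using vc by (auto simp: bordered_def V_def W_def D_def)
  have AZ: "A * Z + V = 0\<^sub>m n 1"
    using A z by (intro eq_matI)
      (auto simp: Z_def V_def v scalar_prod_def row_def sum_negf)
  have WZ: "W * Z + D = E"
    using vc z by (intro eq_matI)
      (auto simp: Z_def W_def D_def E_def scalar_prod_def sum_negf)
  define T where "T = four_block_mat (1\<^sub>m n) Z (0\<^sub>m 1 n) (1\<^sub>m 1)"
  have T: "T \<in> carrier_mat (n + 1) (n + 1)"
    by (auto simp: T_def Z_def)
  have B: "four_block_mat A V W D \<in> carrier_mat (n + 1) (n + 1)"
    using A c by (intro four_block_carrier_mat) auto
  have dT: "det T = 1"
    unfolding T_def using c by (subst det_four_block_mat_lower_left_zero[of _ n _ 1]) auto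
  have "four_block_mat A V W D * T = four_block_mat A (0\<^sub>m n 1) W E"
    unfolding T_def using A c
    by (subst mult_four_block_mat[of _ n n _ 1 _ 1 _ _ n _ 1]) (auto simp: AZ WZ)
  then have "det (bordered A v m) * det T = det (four_block_mat A (0\<^sub>m n 1) W E)"
    using det_mult[OF B T] b by simp
  also have "\<dots> = det A * det E"
    using A c by (intro det_four_block_mat_upper_right_zero) auto
  also have "det E = m - scalar_prod v z"
    by (subst det_single) (auto simp: E_def)
  finally show ?thesis using dT by simp
qed

lemma qform_bordered_expand:
  assumes A: "A \<in> carrier_mat n n" and vc: "v \<in> carrier_vec n" and x: "x \<in> carrier_vec n"
  shows "qform (bordered A v m) (x @\<^sub>v vec 1 (\<lambda>_. t)) = qform A x + 2 * t * scalar_prod v x + t\<^sup>2 * m"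
proof -
  define V where "V = mat n 1 (\<lambda>(i, _). vec_index v i)"
  define W where "W = mat 1 n (\<lambda>(_, j). vec_index v j)"
  define D where "D = mat 1 1 (\<lambda>_. m)"
  define s where "s = vec 1 (\<lambda>_. t)"
  have c: "V \<in> carrier_mat n 1" "W \<in> carrier_mat 1 n"
    "D \<in> carrier_mat 1 1" "s \<in> carrier_vec 1" by (auto simp: V_def W_def D_def s_def)
  have b: "bordered A v m = four_block_mat A V W D"
    using vc by (auto simp: bordered_def V_def W_def D_def)
  have V: "V *\<^sub>v s = t \<cdot>\<^sub>v v"
    using vc by (intro eq_vecI) (auto simp: V_def s_def scalar_prod_def)
  have W: "W *\<^sub>v x + D *\<^sub>v s = vec 1 (\<lambda>_. scalar_prod v x + m * t)"
    using vc x by (intro eq_vecI) (auto simp: W_def D_def s_def scalar_prod_def)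
  have "qform (bordered A v m) (x @\<^sub>v s) =
      scalar_prod (x @\<^sub>v s) ((A *\<^sub>v x + t \<cdot>\<^sub>v v) @\<^sub>v vec 1 (\<lambda>_. scalar_prod v x + m * t))"
    unfolding qform_def b using A c x
    by (subst four_block_mat_mult_vec[of _ n n _ 1 _ 1]) (auto simp: V W)
  also have "\<dots> = scalar_prod x (A *\<^sub>v x + t \<cdot>\<^sub>v v) + t * (scalar_prod v x + m * t)"
    using A c x vc by (subst scalar_prod_append[of _ n _ 1])
      (auto simp: s_def scalar_prod_def)
  also have "\<dots> = qform A x + t * scalar_prod x v + t * scalar_prod v x + t\<^sup>2 * m"
    using A x vc by (simp add: qform_def scalar_prod_add_distrib[of _ n] power2_eq_square algebra_simps)
  finally show ?thesis
    using x vc by (simp add: comm_scalar_prod[of x n v] s_def)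
qed

text \<open>Completing the square: symmetry of A turns the cross term 2 t v.x into 2 t z.(A x),
  which the shift of x by t z absorbs.\<close>

lemma qform_bordered:
  assumes A: "symmetric_mat n A" and z: "z \<in> carrier_vec n" and v: "v = A *\<^sub>v z"
    and x: "x \<in> carrier_vec n"
  shows "qform (bordered A v m) (x @\<^sub>v vec 1 (\<lambda>_. t)) =
    qform A (x + t \<cdot>\<^sub>v z) + t\<^sup>2 * (m - scalar_prod v z)"
proof -
  have Ac: "A \<in> carrier_mat n n" and At: "transpose_mat A = A" using A by (auto simp: symmetric_mat_def)
  have vc: "v \<in> carrier_vec n" using Ac z v by auto
  have sym: "scalar_prod z (A *\<^sub>v x) = scalar_prod v x"
    using transpose_vec_mult_scalar[OF Ac x z] Ac At x z by (simp add: v)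
  have "qform A (x + t \<cdot>\<^sub>v z) = scalar_prod (x + t \<cdot>\<^sub>v z) (A *\<^sub>v x + t \<cdot>\<^sub>v v)"
    unfolding qform_def v using Ac x z
    by (simp add: mult_add_distrib_mat_vec[of _ n n] mult_mat_vec[of _ n n])
  also have "\<dots> = qform A x + t * scalar_prod z (A *\<^sub>v x) + t * scalar_prod x v + t * (t * scalar_prod z v)"
    using Ac x vc z by (simp add: qform_def scalar_prod_add_distrib[of _ n]
      add_scalar_prod_distrib[of _ n] algebra_simps)
  finally show ?thesis unfolding qform_bordered_expand[OF Ac vc x]
    using x vc z by (simp add: sym comm_scalar_prod[of x n v] comm_scalar_prod[of z n v] power2_eq_square algebra_simps)
qed

lemma inverse_mat_exists:
  assumes A: "(A :: real mat) \<in> carrier_mat n n" and "det A \<noteq> 0"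
  obtains B where "B \<in> carrier_mat n n" "A * B = 1\<^sub>m n" "B * A = 1\<^sub>m n"
  using det_non_zero_imp_unit[OF A assms(2), of "()"] by (auto simp: Units_def ring_mat_def)

lemma pos_def_mat_qform:
  "pos_def_mat n A \<longleftrightarrow> symmetric_mat n A \<and> (\<forall>x\<in>carrier_vec n. x \<noteq> 0\<^sub>v n \<longrightarrow> 0 < qform A x)"
  by (simp add: pos_def_mat_def qform_def)

lemma pos_def_mat_qform_nonneg:
  assumes "pos_def_mat n A" "x \<in> carrier_vec n"
  shows "0 \<le> qform A x"
  using assms by (cases "x = 0\<^sub>v n") (auto simp: pos_def_mat_qform qform_def symmetric_mat_def less_imp_le)

lemma symmetric_bordered:
  assumes "symmetric_mat n A" "v \<in> carrier_vec n"
  shows "symmetric_mat (Suc n) (bordered A v m)"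
  unfolding symmetric_mat_def
proof
  have A: "A \<in> carrier_mat n n" "transpose_mat A = A" using assms by (auto simp: symmetric_mat_def)
  then have sym: "A $$ (i, j) = A $$ (j, i)" if "i < n" "j < n" for i j
    using that by (metis carrier_matD index_transpose_mat(1))
  show "bordered A v m \<in> carrier_mat (Suc n) (Suc n)"
    using A assms unfolding bordered_def Suc_eq_plus1
    by (intro four_block_carrier_mat) auto
  then show "transpose_mat (bordered A v m) = bordered A v m"
    using A assms by (intro eq_matI) (auto simp: bordered_def intro!: sym)
qed

lemma carrier_vec_Suc_append:
  assumes "y \<in> carrier_vec (Suc n)"
  obtains x t where "x \<in> carrier_vec n" "y = x @\<^sub>v vec 1 (\<lambda>_. t)"
proof
  show "vec n (vec_index y) \<in> carrier_vec n" by simp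
  show "y = vec n (vec_index y) @\<^sub>v vec 1 (\<lambda>_. vec_index y n)"
    using assms by (intro eq_vecI) (auto simp: less_Suc_eq)
qed

text \<open>Vectors whose last coordinate is 0 see only the block A.\<close>

lemma pos_def_bordered_imp:
  assumes "symmetric_mat n A" "v \<in> carrier_vec n" and pd: "pos_def_mat (Suc n) (bordered A v m)"
  shows "pos_def_mat n A"
  unfolding pos_def_mat_qform
proof (intro conjI ballI impI)
  fix x :: "real vec" assume x: "x \<in> carrier_vec n" "x \<noteq> 0\<^sub>v n"
  have "x @\<^sub>v vec 1 (\<lambda>_. 0) \<noteq> 0\<^sub>v (Suc n)"
  proof
    assume *: "x @\<^sub>v vec 1 (\<lambda>_. 0) = 0\<^sub>v (Suc n)"
    have "vec_index x i = 0" if "i < n" for i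
      using arg_cong[OF *, of "\<lambda>y. vec_index y i"] that x by auto
    with x show False by auto
  qed
  moreover have "x @\<^sub>v vec 1 (\<lambda>_. 0) \<in> carrier_vec (Suc n)"
    unfolding Suc_eq_plus1 using x by (intro append_carrier_vec) auto
  ultimately have "0 < qform (bordered A v m) (x @\<^sub>v vec 1 (\<lambda>_. 0))"
    using pd unfolding pos_def_mat_qform by blast
  then show "0 < qform A x"
    using assms x by (subst (asm) qform_bordered_expand[of _ n]) (auto simp: symmetric_mat_def)
qed fact

lemma pos_def_bordered_iff:
  assumes A: "pos_def_mat n A" and z: "z \<in> carrier_vec n" and v: "v = A *\<^sub>v z"
  shows "pos_def_mat (Suc n) (bordered A v m) \<longleftrightarrow> 0 < m - scalar_prod v z"
proof
  have sA: "symmetric_mat n A" and Ac: "A \<in> carrier_mat n n"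
    using A by (auto simp: pos_def_mat_def symmetric_mat_def)
  have vc: "v \<in> carrier_vec n" using Ac z v by auto
  note qf = qform_bordered[OF sA z v]
  {
    assume pd: "pos_def_mat (Suc n) (bordered A v m)"
    \<comment> \<open>At this vector the completed square vanishes and only the Schur complement is
      left.\<close>
    let ?y = "(- z) @\<^sub>v vec 1 (\<lambda>_. 1)"
    have "?y \<noteq> 0\<^sub>v (Suc n)"
    proof
      assume *: "?y = 0\<^sub>v (Suc n)"
      show False using arg_cong[OF *, of "\<lambda>y. vec_index y n"] z by simp
    qed
    moreover have "?y \<in> carrier_vec (Suc n)"
      unfolding Suc_eq_plus1 using z by (intro append_carrier_vec) auto
    ultimately have "0 < qform (bordered A v m) ?y"
      using pd unfolding pos_def_mat_qform by blast
    also have "\<dots> = qform A (- z + 1 \<cdot>\<^sub>v z) + (m - scalar_prod v z)"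
      using z by (subst qf) auto
    also have "- z + 1 \<cdot>\<^sub>v z = 0\<^sub>v n" using z by (intro eq_vecI) auto
    also have "qform A (0\<^sub>v n) = 0" using Ac by (auto simp: qform_def)
    finally show "0 < m - scalar_prod v z" by simp
  }
  assume s: "0 < m - scalar_prod v z"
  show "pos_def_mat (Suc n) (bordered A v m)"
    unfolding pos_def_mat_qform
  proof (intro conjI ballI impI)
    show "symmetric_mat (Suc n) (bordered A v m)" by (rule symmetric_bordered[OF sA vc])
    fix y :: "real vec" assume y: "y \<in> carrier_vec (Suc n)" "y \<noteq> 0\<^sub>v (Suc n)"
    then obtain x t where x: "x \<in> carrier_vec n" and yx: "y = x @\<^sub>v vec 1 (\<lambda>_. t)"
      by (metis carrier_vec_Suc_append)
    have "0 < qform A (x + t \<cdot>\<^sub>v z) + t\<^sup>2 * (m - scalar_prod v z)"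
    proof (cases "t = 0")
      case True
      have "x \<noteq> 0\<^sub>v n"
      proof
        assume "x = 0\<^sub>v n"
        with True have "y = 0\<^sub>v (Suc n)" by (intro eq_vecI) (auto simp: yx)
        with y show False by simp
      qed
      moreover have "x + 0 \<cdot>\<^sub>v z = x" using x z by (intro eq_vecI) auto
      ultimately show ?thesis using True A x by (simp add: pos_def_mat_qform)
    next
      case False
      then have "0 < t\<^sup>2 * (m - scalar_prod v z)" using s by simp
      then show ?thesis using pos_def_mat_qform_nonneg[OF A, of "x + t \<cdot>\<^sub>v z"] x z by auto
    qed
    then show "0 < qform (bordered A v m) y" unfolding yx qf[OF x] .
  qed
qed

section \<open>Leading minors as functions of the entries, and Sylvester's criterion\<close>

lemma sym_mat_of_carrier [simp]: "sym_mat_of n u \<in> carrier_mat n n"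
  by (simp add: sym_mat_of_def)

lemma symmetric_sym_mat_of [simp]: "symmetric_mat n (sym_mat_of n u)"
  unfolding symmetric_mat_def by (auto simp: sym_mat_of_def min.commute max.commute intro!: eq_matI)

lemma sym_mat_of_Suc:
  "sym_mat_of (Suc n) u = bordered (sym_mat_of n u) (vec n (\<lambda>i. u (i, n))) (u (n, n))"
  by (intro eq_matI) (auto simp: sym_mat_of_def bordered_def less_Suc_eq min_def max_def)

lemma symmetric_mat_eq_sym_mat_of:
  assumes "symmetric_mat n A"
  shows "A = sym_mat_of n (\<lambda>ij. A $$ ij)"
proof -
  have A: "A \<in> carrier_mat n n" "transpose_mat A = A" using assms by (auto simp: symmetric_mat_def)
  then have "A $$ (i, j) = A $$ (j, i)" if "i < n" "j < n" for i j
    using that by (metis carrier_matD index_transpose_mat(1))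
  with A show ?thesis by (intro eq_matI) (auto simp: sym_mat_of_def min_def max_def)
qed

text \<open>The argument is the family of entries and not a matrix, so that minors of all orders are
  evaluated at one point of the product space and depend only on the entries of their own
  block.\<close>

definition minor :: "nat \<Rightarrow> (nat \<times> nat \<Rightarrow> real) \<Rightarrow> real" where
  "minor j u = det (sym_mat_of j u)"

definition cominor :: "nat \<Rightarrow> (nat \<times> nat \<Rightarrow> real) \<Rightarrow> real" where
  "cominor j u = det (1\<^sub>m j - sym_mat_of j u)"

lemma minor_0 [simp]: "minor 0 u = 1" and cominor_0 [simp]: "cominor 0 u = 1"
  by (simp_all add: minor_def cominor_def det_dim_zero minus_carrier_mat)

text \<open>The entries of the complement I - U; they transfer every fact about minors to the minors
  of the complement.\<close>

definition co_entries :: "(nat \<times> nat \<Rightarrow> real) \<Rightarrow> nat \<times> nat \<Rightarrow> real" where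
  "co_entries u ij = (if fst ij = snd ij then 1 else 0) - u ij"

lemma one_minus_sym_mat_of: "1\<^sub>m n - sym_mat_of n u = sym_mat_of n (co_entries u)"
  by (intro eq_matI) (auto simp: sym_mat_of_def co_entries_def min_def max_def)

lemma cominor_eq_minor: "cominor j u = minor j (co_entries u)"
  by (simp add: minor_def cominor_def one_minus_sym_mat_of)

text \<open>Sylvester's criterion. Passing from order n to n + 1 multiplies the minor by the Schur
  complement, whose sign decides whether positive definiteness persists. The criterion turns the
  support condition of the density into finitely many polynomial inequalities, which are measurable
  and of which only two involve the last column.\<close>

lemma pos_def_iff_minors_pos:
  "pos_def_mat n (sym_mat_of n u) \<longleftrightarrow> (\<forall>j\<in>{1..n}. 0 < minor j u)"
proof (induction n)
  case 0
  show ?case by (auto simp: pos_def_mat_def)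
next
  case (Suc n)
  let ?A = "sym_mat_of n u" and ?v = "vec n (\<lambda>i. u (i, n))"
  show ?case
  proof (cases "pos_def_mat n ?A")
    case False
    then have "\<not> pos_def_mat (Suc n) (sym_mat_of (Suc n) u)"
      unfolding sym_mat_of_Suc using pos_def_bordered_imp[of n ?A ?v] by auto
    moreover have "\<not> (\<forall>j\<in>{1..n}. 0 < minor j u)" using False Suc.IH by simp
    ultimately show ?thesis by (meson atLeastAtMost_iff le_SucI)
  next
    case True
    then have "0 < minor n u" using Suc.IH by (cases "n = 0") auto
    then obtain B where B: "B \<in> carrier_mat n n" "?A * B = 1\<^sub>m n" "B * ?A = 1\<^sub>m n"
      using inverse_mat_exists[of ?A n] by (auto simp: minor_def)
    define z where "z = B *\<^sub>v ?v"
    have z: "z \<in> carrier_vec n" using B by (auto simp: z_def)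
    have v: "?v = ?A *\<^sub>v z" unfolding z_def using B
      by (subst assoc_mult_mat_vec[symmetric, of _ n n _ n]) auto
    have "minor (Suc n) u = minor n u * (u (n, n) - scalar_prod ?v z)"
      unfolding minor_def sym_mat_of_Suc by (rule det_bordered[OF _ z v]) simp
    then have "pos_def_mat (Suc n) (sym_mat_of (Suc n) u) \<longleftrightarrow> 0 < minor (Suc n) u"
      unfolding sym_mat_of_Suc pos_def_bordered_iff[OF True z v]
      using \<open>0 < minor n u\<close> by (simp add: zero_less_mult_iff)
    then show ?thesis using True Suc.IH by (auto simp: le_Suc_eq)
  qed
qed

lemma between_0_I_iff_minors_pos:
  "between_0_I n (sym_mat_of n u) \<longleftrightarrow> (\<forall>j\<in>{1..n}. 0 < minor j u \<and> 0 < cominor j u)"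
proof -
  have "sym_mat_of n u - 0\<^sub>m n n = sym_mat_of n u" by (intro eq_matI) (auto simp: sym_mat_of_def)
  then show ?thesis
    by (auto simp: between_0_I_def loewner_less_def one_minus_sym_mat_of cominor_eq_minor
        pos_def_iff_minors_pos)
qed

section \<open>Schur complements of a block and of its complement\<close>

lemma pos_def_mat_det_pos:
  assumes "pos_def_mat n A"
  shows "0 < det A"
proof -
  have A: "A = sym_mat_of n (\<lambda>ij. A $$ ij)"
    using assms by (intro symmetric_mat_eq_sym_mat_of) (auto simp: pos_def_mat_def)
  show ?thesis using assms
    by (subst A, subst (asm) A, subst (asm) pos_def_iff_minors_pos)
      (cases "n = 0", auto simp: minor_def sym_mat_of_def)
qed

text \<open>The substitution y = B x turns \<open>qform A y\<close> into \<open>qform B x\<close>,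
  which carries positivity over to the inverse; the determinant formula is
  \<open>det_bordered\<close> with z = B v.\<close>

lemma pos_def_mat_inverse:
  assumes A: "pos_def_mat n A"
  obtains B where "pos_def_mat n B" "A * B = 1\<^sub>m n" "B * A = 1\<^sub>m n"
    "\<And>v m. v \<in> carrier_vec n \<Longrightarrow> det (bordered A v m) = det A * (m - qform B v)"
proof -
  have Ac: "A \<in> carrier_mat n n" and At: "transpose_mat A = A"
    using A by (auto simp: pos_def_mat_def symmetric_mat_def)
  obtain B where B: "B \<in> carrier_mat n n" "A * B = 1\<^sub>m n" "B * A = 1\<^sub>m n"
    using inverse_mat_exists[OF Ac] pos_def_mat_det_pos[OF A] by auto
  have ABv: "A *\<^sub>v (B *\<^sub>v v) = v" if "v \<in> carrier_vec n" for v
    using that B Ac by (subst assoc_mult_mat_vec[symmetric, of _ n n _ n]) auto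
  have "transpose_mat B * A = 1\<^sub>m n"
    using transpose_mult[OF Ac B(1)] B At by simp
  then have "transpose_mat B = transpose_mat B * A * B"
    using B Ac by (subst assoc_mult_mat[of _ n n _ n _ n]) auto
  also have "\<dots> = B" using \<open>transpose_mat B * A = 1\<^sub>m n\<close> B by simp
  finally have sB: "symmetric_mat n B" using B by (simp add: symmetric_mat_def)
  show thesis
  proof (rule that[OF _ B(2,3)])
    show "pos_def_mat n B" unfolding pos_def_mat_qform
    proof (intro conjI ballI impI)
      fix x :: "real vec" assume x: "x \<in> carrier_vec n" "x \<noteq> 0\<^sub>v n"
      have y: "B *\<^sub>v x \<in> carrier_vec n" using x B by auto
      have "B *\<^sub>v x \<noteq> 0\<^sub>v n"
      proof
        assume "B *\<^sub>v x = 0\<^sub>v n"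
        with ABv[OF x(1)] Ac have "x = 0\<^sub>v n" by auto
        with x show False by simp
      qed
      with y A have "0 < qform A (B *\<^sub>v x)" by (simp add: pos_def_mat_qform)
      also have "qform A (B *\<^sub>v x) = qform B x"
        unfolding qform_def ABv[OF x(1)] using x y by (simp add: comm_scalar_prod[of _ n])
      finally show "0 < qform B x" .
    qed fact
    fix v :: "real vec" and m assume v: "v \<in> carrier_vec n"
    then have "B *\<^sub>v v \<in> carrier_vec n" using B by auto
    from det_bordered[OF Ac this ABv[OF v, symmetric], of m]
    show "det (bordered A v m) = det A * (m - qform B v)" by (simp add: qform_def)
  qed
qed

text \<open>The form of the inverse of I - A is written as \<open>qform Q v - qform B v\<close>: in
  terms of s = m - \<open>qform B v\<close> the second quotient is then 1 - s -
  \<open>qform Q v\<close>, and B drops out of it.\<close>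

lemma schur_pair:
  assumes A: "pos_def_mat n A" and A': "pos_def_mat n (1\<^sub>m n - A)"
  obtains B Q where "B \<in> carrier_mat n n" "pos_def_mat n Q" "det A * det (1\<^sub>m n - A) * det Q = 1"
    "\<And>v m. v \<in> carrier_vec n \<Longrightarrow> det (bordered A v m) = det A * (m - qform B v)"
    "\<And>v m. v \<in> carrier_vec n \<Longrightarrow> det (1\<^sub>m (Suc n) - bordered A v m) =
       det (1\<^sub>m n - A) * (1 - m - (qform Q v - qform B v))"
proof -
  define A' where "A' = 1\<^sub>m n - A"
  have c: "A \<in> carrier_mat n n" "A' \<in> carrier_mat n n"
    using assms by (auto simp: pos_def_mat_def symmetric_mat_def A'_def)
  obtain B where pB: "pos_def_mat n B" and AB: "A * B = 1\<^sub>m n" "B * A = 1\<^sub>m n"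
    and B: "\<And>v m. v \<in> carrier_vec n \<Longrightarrow> det (bordered A v m) = det A * (m - qform B v)"
    using pos_def_mat_inverse[OF assms(1)] by blast
  obtain C where pC: "pos_def_mat n C" and A'C: "A' * C = 1\<^sub>m n" "C * A' = 1\<^sub>m n"
    and C: "\<And>v m. v \<in> carrier_vec n \<Longrightarrow> det (bordered A' v m) = det A' * (m - qform C v)"
    using pos_def_mat_inverse[OF assms(2)] unfolding A'_def by blast
  have cBC: "B \<in> carrier_mat n n" "C \<in> carrier_mat n n"
    using pB pC by (auto simp: pos_def_mat_def symmetric_mat_def)
  \<comment> \<open>Inserting I = (I - A) + A between the two inverses gives B C = B + C, so the
    determinant of Q = B + C is a product.\<close>
  have "B * C = B * ((A' + A) * C)"
  proof -
    have "A' + A = 1\<^sub>m n" using c by (intro eq_matI) (auto simp: A'_def)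
    then show ?thesis using cBC by simp
  qed
  also have "\<dots> = B * (A' * C) + B * A * C"
    using c cBC by (simp add: add_mult_distrib_mat[of _ n n] mult_add_distrib_mat[of _ n n _ n] assoc_mult_mat[of _ n n _ n _ n])
  also have "\<dots> = B + C" using cBC by (simp add: AB A'C)
  finally have BC: "B * C = B + C" .
  have dQ: "det (B + C) = det B * det C" using det_mult[OF cBC] BC by simp
  have d1: "det A * det B = 1" "det A' * det C = 1"
    using det_mult[OF c(1) cBC(1)] det_mult[OF c(2) cBC(2)] by (simp_all add: AB A'C)
  have qQ: "qform (B + C) v = qform B v + qform C v" if "v \<in> carrier_vec n" for v
    using that cBC by (simp add: qform_def add_mult_distrib_mat_vec[of _ n n] scalar_prod_add_distrib[of _ n])
  have pQ: "pos_def_mat n (B + C)"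
    using pB pC cBC by (auto simp: pos_def_mat_qform symmetric_mat_def qQ transpose_add[of _ n n] add_pos_pos)
  show thesis
  proof (rule that[OF cBC(1) pQ _ B])
    show "det A * det (1\<^sub>m n - A) * det (B + C) = 1"
      using d1 by (simp add: dQ A'_def[symmetric] algebra_simps)
    fix v :: "real vec" and m assume v: "v \<in> carrier_vec n"
    \<comment> \<open>The complement is bordered by -v; the sign disappears in the quadratic
      form.\<close>
    have "1\<^sub>m (Suc n) - bordered A v m = bordered A' (- v) (1 - m)"
      using c v by (intro eq_matI) (auto simp: bordered_def A'_def)
    moreover have "qform C (- v) = qform C v"
      using v cBC by (auto simp: qform_def scalar_prod_def mult_mat_vec_def sum_negf)
    ultimately show "det (1\<^sub>m (Suc n) - bordered A v m) =
       det (1\<^sub>m n - A) * (1 - m - (qform (B + C) v - qform B v))"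
      using C[of "- v" "1 - m"] v qQ[OF v] by (simp add: A'_def)
  qed
qed

lemma sym_mat_of_cong:
  assumes "\<And>ij. ij \<in> upper_index n \<Longrightarrow> u ij = w ij"
  shows "sym_mat_of n u = sym_mat_of n w"
  using assms by (intro eq_matI) (auto simp: sym_mat_of_def upper_index_def)

text \<open>B and Q are chosen from the block of order n alone, before the extension w. They can
  therefore be held fixed while the last column and the corner are integrated.\<close>

lemma minors_Suc:
  assumes "between_0_I n (sym_mat_of n u)"
  obtains B Q where "B \<in> carrier_mat n n" "pos_def_mat n Q" "minor n u * cominor n u * det Q = 1"
    "\<And>w. (\<And>ij. ij \<in> upper_index n \<Longrightarrow> u ij = w ij) \<Longrightarrow>
       minor (Suc n) w = minor n u * (w (n, n) - qform B (vec n (\<lambda>i. w (i, n))))"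
    "\<And>w. (\<And>ij. ij \<in> upper_index n \<Longrightarrow> u ij = w ij) \<Longrightarrow>
       cominor (Suc n) w = cominor n u *
         (1 - w (n, n) - (qform Q (vec n (\<lambda>i. w (i, n))) - qform B (vec n (\<lambda>i. w (i, n)))))"
proof -
  have "sym_mat_of n u - 0\<^sub>m n n = sym_mat_of n u" by (intro eq_matI) (auto simp: sym_mat_of_def)
  then have "pos_def_mat n (sym_mat_of n u)" "pos_def_mat n (1\<^sub>m n - sym_mat_of n u)"
    using assms by (auto simp: between_0_I_def loewner_less_def)
  then obtain B Q where 1: "B \<in> carrier_mat n n" "pos_def_mat n Q"
    "det (sym_mat_of n u) * det (1\<^sub>m n - sym_mat_of n u) * det Q = 1"
    "\<And>v m. v \<in> carrier_vec n \<Longrightarrow> det (bordered (sym_mat_of n u) v m) = det (sym_mat_of n u) * (m - qform B v)"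
    "\<And>v m. v \<in> carrier_vec n \<Longrightarrow> det (1\<^sub>m (Suc n) - bordered (sym_mat_of n u) v m) =
       det (1\<^sub>m n - sym_mat_of n u) * (1 - m - (qform Q v - qform B v))"
    by (rule schur_pair) blast
  show thesis
  proof (rule that[OF 1(1,2)])
    show "minor n u * cominor n u * det Q = 1" using 1(3) by (simp add: minor_def cominor_def)
    fix w :: "nat \<times> nat \<Rightarrow> real" assume "\<And>ij. ij \<in> upper_index n \<Longrightarrow> u ij = w ij"
    then have "sym_mat_of n w = sym_mat_of n u" by (metis sym_mat_of_cong)
    then show "minor (Suc n) w = minor n u * (w (n, n) - qform B (vec n (\<lambda>i. w (i, n))))"
      "cominor (Suc n) w = cominor n u *
         (1 - w (n, n) - (qform Q (vec n (\<lambda>i. w (i, n))) - qform B (vec n (\<lambda>i. w (i, n)))))"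
      by (simp_all add: minor_def cominor_def sym_mat_of_Suc 1)
  qed
qed

subsection \<open>Quadratic forms and Lebesgue measure\<close>

text \<open>Boxes determine the product measure, and each side is moved by one-dimensional
  translation invariance. The lemma removes the shift t z of a completed square.\<close>

lemma nn_integral_PiM_lborel_translate:
  fixes c :: "'i \<Rightarrow> real"
  assumes I: "finite I" and f: "f \<in> borel_measurable (\<Pi>\<^sub>M i\<in>I. lborel)"
  shows "(\<integral>\<^sup>+x. f (\<lambda>i\<in>I. x i + c i) \<partial>(\<Pi>\<^sub>M i\<in>I. lborel)) = (\<integral>\<^sup>+x. f x \<partial>(\<Pi>\<^sub>M i\<in>I. lborel))"
proof -
  interpret product_sigma_finite "\<lambda>_::'i. lborel :: real measure" by standard
  let ?P = "\<Pi>\<^sub>M i\<in>I. (lborel :: real measure)"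
  let ?T = "\<lambda>x. \<lambda>i\<in>I. x i + c i"
  have T: "?T \<in> measurable ?P ?P" by measurable
  have "distr ?P ?P ?T = ?P"
  proof (rule PiM_eqI[OF I])
    fix A :: "'i \<Rightarrow> real set" assume A: "\<And>i. i \<in> I \<Longrightarrow> A i \<in> sets lborel"
    have V: "(\<lambda>x. c i + x) -` A i \<in> sets lborel" if "i \<in> I" for i
    proof -
      have "(\<lambda>x. c i + x) -` A i \<inter> space lborel \<in> sets lborel"
        using A[OF that] by (intro measurable_sets[of _ _ lborel]) auto
      then show ?thesis by simp
    qed
    have "emeasure (distr ?P ?P ?T) (Pi\<^sub>E I A) = emeasure ?P (?T -` Pi\<^sub>E I A \<inter> space ?P)"
      using A I by (intro emeasure_distr[OF T] sets_PiM_I_finite) auto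
    also have "?T -` Pi\<^sub>E I A \<inter> space ?P = Pi\<^sub>E I (\<lambda>i. (\<lambda>x. c i + x) -` A i)"
      by (auto simp: space_PiM PiE_iff extensional_def add.commute)
    also have "emeasure ?P \<dots> = (\<Prod>i\<in>I. emeasure lborel ((\<lambda>x. c i + x) -` A i))"
      using V by (intro emeasure_PiM I) auto
    also have "\<dots> = (\<Prod>i\<in>I. emeasure lborel (A i))"
    proof (intro prod.cong refl)
      fix i assume "i \<in> I"
      then have "emeasure lborel (A i) = emeasure (distr lborel borel ((+) (c i))) (A i)"
        by (simp add: lborel_distr_plus)
      also have "\<dots> = emeasure lborel ((\<lambda>x. c i + x) -` A i)"
        using A[OF \<open>i \<in> I\<close>] by (subst emeasure_distr) auto
      finally show "emeasure lborel ((\<lambda>x. c i + x) -` A i) = emeasure lborel (A i)" ..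
    qed
    finally show "emeasure (distr ?P ?P ?T) (Pi\<^sub>E I A) = (\<Prod>i\<in>I. emeasure lborel (A i))" .
  qed simp
  then have "(\<integral>\<^sup>+x. f x \<partial>?P) = (\<integral>\<^sup>+x. f x \<partial>distr ?P ?P ?T)" by simp
  also have "\<dots> = (\<integral>\<^sup>+x. f (?T x) \<partial>?P)" using f by (intro nn_integral_distr[OF T]) simp
  finally show ?thesis ..
qed

lemma qform_vec:
  assumes "A \<in> carrier_mat n n"
  shows "qform A (vec n g) = (\<Sum>i<n. \<Sum>j<n. A $$ (i, j) * g i * g j)"
  using assms by (auto simp: qform_def scalar_prod_def sum_distrib_left atLeast0LessThan mult_ac intro!: sum.cong)

lemma measurable_qform:
  assumes "A \<in> carrier_mat n n" "e ` {..<n} \<subseteq> I"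
  shows "(\<lambda>x. qform A (vec n (\<lambda>i. x (e i)))) \<in> borel_measurable (\<Pi>\<^sub>M i\<in>I. lborel)"
  unfolding qform_vec[OF assms(1)]
proof (intro borel_measurable_sum borel_measurable_times borel_measurable_const)
  show "(\<lambda>x. x (e i)) \<in> borel_measurable (\<Pi>\<^sub>M i\<in>I. lborel)" if "i \<in> {..<n}" for i
    using measurable_component_singleton[of "e i" I "\<lambda>_. lborel"] assms that by auto
  show "(\<lambda>x. x (e i)) \<in> borel_measurable (\<Pi>\<^sub>M i\<in>I. lborel)" if "i \<in> {..<n}" for i
    using measurable_component_singleton[of "e i" I "\<lambda>_. lborel"] assms that by auto
qed

text \<open>The proof completes the square: \<open>x\<^sup>T Q x = (y + t z)\<^sup>T A (y + t z) + t\<^sup>2 s\<close> for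
  \<open>x = (y, t)\<close>, where \<open>s\<close> is the Schur complement of \<open>A\<close> in \<open>Q\<close>.\<close>

lemma nn_integral_qform:
  fixes f :: "real \<Rightarrow> ennreal" and e :: "nat \<Rightarrow> 'i"
  assumes "pos_def_mat n Q" "inj_on e {..<n}" "f \<in> borel_measurable borel"
  shows "(\<integral>\<^sup>+x. f (qform Q (vec n (\<lambda>i. x (e i)))) \<partial>(\<Pi>\<^sub>M k\<in>e ` {..<n}. lborel)) =
    ennreal (1 / sqrt (det Q)) * (\<integral>\<^sup>+x. f (\<Sum>k\<in>e ` {..<n}. (x k)\<^sup>2) \<partial>(\<Pi>\<^sub>M k\<in>e ` {..<n}. lborel))"
  using assms
proof (induction n arbitrary: Q f)
  case 0
  have "qform Q (vec 0 g) = 0" for g by (simp add: qform_def scalar_prod_def)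
  moreover have "det Q = 1" using 0 by (auto simp: pos_def_mat_def symmetric_mat_def det_dim_zero)
  ultimately show ?case by simp
next
  case (Suc n)
  interpret product_sigma_finite "\<lambda>_::'i. lborel :: real measure" by standard
  note f[measurable] = \<open>f \<in> borel_measurable borel\<close>
  define I where "I = e ` {..<n}"
  define P where "P = (\<Pi>\<^sub>M k\<in>I. (lborel :: real measure))"
  have I: "finite I" "e n \<notin> I" "e ` {..<Suc n} = insert (e n) I" and inj: "inj_on e {..<n}"
    using Suc.prems(2) by (auto simp: I_def inj_on_def lessThan_Suc)
  interpret P: sigma_finite_measure P unfolding P_def by (rule sigma_finite[OF I(1)])
  define q where "q = (\<lambda>ij. Q $$ ij)"
  define A where "A = sym_mat_of n q"
  define v where "v = vec n (\<lambda>i. q (i, n))"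
  have Q: "Q = bordered A v (q (n, n))"
    using Suc.prems(1) by (subst symmetric_mat_eq_sym_mat_of[of "Suc n" Q])
      (auto simp: pos_def_mat_def q_def A_def v_def sym_mat_of_Suc)
  have Qc: "Q \<in> carrier_mat (Suc n) (Suc n)"
    using Suc.prems(1) by (auto simp: pos_def_mat_def symmetric_mat_def)
  have A: "pos_def_mat n A"
    using Suc.prems(1) unfolding Q by (intro pos_def_bordered_imp[of n A v]) (auto simp: A_def v_def)
  have Ac: "A \<in> carrier_mat n n" and sA: "symmetric_mat n A" and v: "v \<in> carrier_vec n"
    by (auto simp: A_def v_def)
  obtain B where B: "B \<in> carrier_mat n n" "A * B = 1\<^sub>m n" "B * A = 1\<^sub>m n"
    using inverse_mat_exists[OF Ac] pos_def_mat_det_pos[OF A] by auto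
  define z where "z = B *\<^sub>v v"
  have z: "z \<in> carrier_vec n" using B v by (auto simp: z_def)
  have Az: "v = A *\<^sub>v z" unfolding z_def using B v Ac
    by (subst assoc_mult_mat_vec[symmetric, of _ n n _ n]) auto
  define s where "s = q (n, n) - scalar_prod v z"
  have s: "0 < s" using Suc.prems(1) pos_def_bordered_iff[OF A z Az] by (simp add: Q s_def)
  have dQ: "det Q = det A * s" unfolding Q s_def by (rule det_bordered[OF Ac z Az])
  have dA: "0 < det A" by (rule pos_def_mat_det_pos[OF A])
  define N where "N x = (\<Sum>k\<in>I. (x k)\<^sup>2)" for x :: "'i \<Rightarrow> real"
  define w where "w x = vec n (\<lambda>i. x (e i))" for x :: "'i \<Rightarrow> real"
  have [measurable]: "(\<lambda>x. qform A (w x)) \<in> borel_measurable P"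
    unfolding w_def P_def by (rule measurable_qform[OF Ac]) (simp add: I_def)
  have [measurable]: "N \<in> borel_measurable P"
    unfolding N_def P_def by measurable
  have shift: "(\<integral>\<^sup>+x. f (qform A (w x + t \<cdot>\<^sub>v z) + t\<^sup>2 * s) \<partial>P) =
      ennreal (1 / sqrt (det A)) * (\<integral>\<^sup>+x. f (N x + (sqrt s * t)\<^sup>2) \<partial>P)" for t
  proof -
    \<comment> \<open>Coordinates are labelled by \<open>e i\<close> and entries of z by i, so the
      shift is carried back along the inverse of e.\<close>
    define c where "c k = t * vec_index z (inv_into {..<n} e k)" for k
    have "w x + t \<cdot>\<^sub>v z = w (\<lambda>k\<in>I. x k + c k)" for x
      using z inj by (intro eq_vecI) (auto simp: w_def I_def c_def)
    then have "(\<integral>\<^sup>+x. f (qform A (w x + t \<cdot>\<^sub>v z) + t\<^sup>2 * s) \<partial>P) =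
        (\<integral>\<^sup>+x. f (qform A (w x) + t\<^sup>2 * s) \<partial>P)"
      using nn_integral_PiM_lborel_translate[OF I(1), of "\<lambda>x. f (qform A (w x) + t\<^sup>2 * s)" c]
      unfolding P_def[symmetric] by simp
    also have "\<dots> = ennreal (1 / sqrt (det A)) * (\<integral>\<^sup>+x. f (N x + t\<^sup>2 * s) \<partial>P)"
      unfolding w_def N_def P_def I_def by (rule Suc.IH[OF A inj, of "\<lambda>r. f (r + t\<^sup>2 * s)"]) measurable
    finally show ?thesis using s by (simp add: power_mult_distrib mult.commute)
  qed
  have ne: "e i \<noteq> e n" if "i < n" for i using I(2) that unfolding I_def by (metis imageI lessThan_iff)
  have vec_Suc: "vec (Suc n) (\<lambda>i. (x(e n := t)) (e i)) = w x @\<^sub>v vec 1 (\<lambda>_. t)" for x t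
    by (intro eq_vecI) (auto simp: w_def less_Suc_eq ne)
  define h where "h t = (\<integral>\<^sup>+x. f (N x + t\<^sup>2) \<partial>P)" for t
  have [measurable]: "h \<in> borel_measurable borel" unfolding h_def by measurable
  have "(\<integral>\<^sup>+x. f (qform Q (vec (Suc n) (\<lambda>i. x (e i)))) \<partial>(\<Pi>\<^sub>M k\<in>insert (e n) I. lborel)) =
     (\<integral>\<^sup>+t. \<integral>\<^sup>+x. f (qform Q (vec (Suc n) (\<lambda>i. (x(e n := t)) (e i)))) \<partial>P \<partial>lborel)"
    unfolding P_def using I measurable_qform[OF Qc, of e "insert (e n) I"]
    by (intro product_nn_integral_insert_rev) (auto intro: measurable_compose[OF _ f])
  also have "\<dots> = (\<integral>\<^sup>+t. \<integral>\<^sup>+x. f (qform A (w x + t \<cdot>\<^sub>v z) + t\<^sup>2 * s) \<partial>P \<partial>lborel)"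
    unfolding vec_Suc unfolding Q
    by (subst qform_bordered[OF sA z Az]) (auto simp: w_def s_def)
  also have "\<dots> = (\<integral>\<^sup>+t. ennreal (1 / sqrt (det A)) * h (sqrt s * t) \<partial>lborel)"
    unfolding shift h_def ..
  also have "\<dots> = ennreal (1 / sqrt (det A)) * (\<integral>\<^sup>+t. h (sqrt s * t) \<partial>lborel)"
    by (rule nn_integral_cmult) measurable
  \<comment> \<open>Scaling the last coordinate contributes 1 / sqrt s, which joins the inductive
    factor 1 / sqrt (det A) because det Q = det A * s.\<close>
  also have "(\<integral>\<^sup>+t. h (sqrt s * t) \<partial>lborel) = ennreal (1 / sqrt s) * (\<integral>\<^sup>+t. h t \<partial>lborel)"
    using s nn_integral_real_affine[of h "sqrt s" 0]
    by (auto simp: mult.assoc[symmetric] ennreal_mult'[symmetric])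
  also have "ennreal (1 / sqrt (det A)) * (ennreal (1 / sqrt s) * (\<integral>\<^sup>+t. h t \<partial>lborel)) =
      ennreal (1 / sqrt (det Q)) * (\<integral>\<^sup>+t. h t \<partial>lborel)"
    using s dA by (simp add: dQ real_sqrt_mult mult.assoc[symmetric] ennreal_mult'[symmetric])
  also have "(\<integral>\<^sup>+t. h t \<partial>lborel) =
      (\<integral>\<^sup>+t. \<integral>\<^sup>+x. f (\<Sum>k\<in>insert (e n) I. ((x(e n := t)) k)\<^sup>2) \<partial>P \<partial>lborel)"
  proof -
    have "(\<Sum>k\<in>insert (e n) I. ((x(e n := t)) k)\<^sup>2) = N x + t\<^sup>2" for x t
    proof -
      have "(\<Sum>k\<in>I. ((x(e n := t)) k)\<^sup>2) = N x"
        unfolding N_def using I(2) by (intro sum.cong) auto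
      then show ?thesis using I by simp
    qed
    then show ?thesis by (simp add: h_def)
  qed
  also have "\<dots> = (\<integral>\<^sup>+x. f (\<Sum>k\<in>insert (e n) I. (x k)\<^sup>2) \<partial>(\<Pi>\<^sub>M k\<in>insert (e n) I. lborel))"
    unfolding P_def using I
    by (intro product_nn_integral_insert_rev[symmetric]) (auto intro!: measurable_compose[OF _ f])
  finally show ?case by (simp add: I(3))
qed

text \<open>The set where the sum of squares is at most a is a ball of radius sqrt a, of volume
  \<open>unit_ball_vol n * a powr (n / 2)\<close>. The derivative in a yields the density with its
  constant n / 2. The two measures are compared on the half-lines \<open>{..a}\<close>, which are
  stable under intersection and generate the Borel sets.\<close>

lemma nn_integral_sum_squares:
  fixes f :: "real \<Rightarrow> ennreal" and I :: "'i set"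
  assumes I: "finite I" "I \<noteq> {}" and f[measurable]: "f \<in> borel_measurable borel"
  shows "(\<integral>\<^sup>+x. f (\<Sum>k\<in>I. (x k)\<^sup>2) \<partial>(\<Pi>\<^sub>M k\<in>I. lborel)) =
    ennreal (unit_ball_vol (card I) * card I / 2) *
      (\<integral>\<^sup>+r. ennreal (indicator {0..} r * r powr (card I / 2 - 1)) * f r \<partial>lborel)"
proof -
  interpret product_sigma_finite "\<lambda>_::'i. lborel :: real measure" by standard
  define P where "P = (\<Pi>\<^sub>M k\<in>I. (lborel :: real measure))"
  define N where "N x = (\<Sum>k\<in>I. (x k)\<^sup>2)" for x :: "'i \<Rightarrow> real"
  define n where "n = real (card I)"
  define C where "C = unit_ball_vol n * n / 2"
  define g where "g r = indicator {0..} r * r powr (n / 2 - 1)" for r :: real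
  have n: "0 < n" using I by (simp add: n_def card_gt_0_iff)
  have C: "0 \<le> C" using n by (simp add: C_def)
  have [measurable]: "N \<in> borel_measurable P" unfolding N_def P_def by measurable
  have [measurable]: "g \<in> borel_measurable borel" unfolding g_def by measurable
  define \<nu> where "\<nu> = density lborel (\<lambda>r. ennreal (C * g r))"
  have N0: "0 \<le> N x" for x by (simp add: N_def sum_nonneg)
  have 1: "emeasure (distr P borel N) {..a} = (if 0 < a then ennreal (unit_ball_vol n * a powr (n / 2)) else 0)" for a
  proof -
    have e: "emeasure (distr P borel N) {..a} = emeasure P ({x. N x \<le> a} \<inter> space P)"
      by (subst emeasure_distr) (auto intro!: arg_cong[where f = "emeasure P"])
    consider "0 < a" | "a = 0" | "a < 0" by linarith
    then show ?thesis
    proof cases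
      case 1
      have "{x. N x \<le> a} = {x. sqrt (\<Sum>i\<in>I. (x i)\<^sup>2) \<le> sqrt a}" by (auto simp: N_def)
      with 1 emeasure_cball_aux[OF I(1), of "sqrt a"]
      have "emeasure P ({x. N x \<le> a} \<inter> space P) = ennreal (unit_ball_vol n * sqrt a ^ card I)"
        by (simp add: P_def n_def)
      also have "sqrt a ^ card I = a powr (n / 2)"
        using 1 by (simp add: powr_half_sqrt[symmetric] powr_power n_def)
      finally show ?thesis using 1 e by simp
    next
      \<comment> \<open>The set is the single point with all coordinates 0, which is null because I
        is nonempty; for an empty index set the law would be a point mass.\<close>
      case 2
      have "{x. N x \<le> a} \<inter> space P = Pi\<^sub>E I (\<lambda>_. {0})"
        using I N0 by (auto simp: 2 P_def space_PiM PiE_iff N_def sum_nonneg_eq_0_iff order_antisym_conv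
            intro!: extensionalityI[where A = I])
      also have "emeasure P \<dots> = (\<Prod>i\<in>I. emeasure lborel {0 :: real})"
        unfolding P_def by (rule emeasure_PiM) (use I in auto)
      also have "\<dots> = 0" using I by auto
      finally show ?thesis using 2 e by simp
    next
      case 3
      then have "{x. N x \<le> a} = {}" using N0 by (smt (verit) empty_Collect_eq)
      then show ?thesis using 3 e by simp
    qed
  qed
  have 2: "emeasure \<nu> {..a} = (if 0 < a then ennreal (unit_ball_vol n * a powr (n / 2)) else 0)" for a
  proof -
    have "emeasure \<nu> {..a} = (\<integral>\<^sup>+r. ennreal (C * g r) * indicator {..a} r \<partial>lborel)"
      unfolding \<nu>_def by (subst emeasure_density) auto
    also have "\<dots> = (\<integral>\<^sup>+r. ennreal (indicator {0..a} r * (C * r powr (n / 2 - 1))) \<partial>lborel)"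
      by (intro nn_integral_cong) (auto simp: g_def indicator_def)
    also have "\<dots> = (if 0 < a then ennreal (unit_ball_vol n * a powr (n / 2)) else 0)"
    proof (cases "0 < a")
      case True
      have "((\<lambda>r. C * r powr (n / 2 - 1)) has_integral C * (a powr (n / 2 - 1 + 1) / (n / 2 - 1 + 1))) {0..a}"
        using True n by (intro has_integral_mult_right has_integral_powr_from_0) auto
      also have "C * (a powr (n / 2 - 1 + 1) / (n / 2 - 1 + 1)) = unit_ball_vol n * a powr (n / 2)"
        using n by (simp add: C_def)
      finally have hi: "((\<lambda>r. C * r powr (n / 2 - 1)) has_integral unit_ball_vol n * a powr (n / 2)) {0..a}" .
      have "(\<integral>\<^sup>+r. ennreal (indicator {0..a} r * (C * r powr (n / 2 - 1))) \<partial>lborel) =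
          ennreal (unit_ball_vol n * a powr (n / 2))"
        by (rule nn_integral_has_integral_lebesgue[OF _ hi]) (use C in auto)
      then show ?thesis using True by simp
    next
      case False
      then have "ennreal (indicator {0..a} r * (C * r powr (n / 2 - 1))) = 0" for r
        by (cases "r = 0") (auto simp: indicator_def)
      then show ?thesis using False by simp
    qed
    finally show ?thesis .
  qed
  have eq: "distr P borel N = \<nu>"
  proof (rule measure_eqI_generator_eq)
    show "Int_stable (range (\<lambda>a::real. {..a}))" by (auto simp: Int_stable_def)
    show "range (\<lambda>a::real. {..a}) \<subseteq> Pow UNIV" by simp
    show "sets (distr P borel N) = sigma_sets UNIV (range (\<lambda>a::real. {..a}))"
      by (simp add: borel_eq_atMost)
    show "sets \<nu> = sigma_sets UNIV (range (\<lambda>a::real. {..a}))"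
      by (simp add: \<nu>_def borel_eq_atMost)
    show "range (\<lambda>i::nat. {..real i}) \<subseteq> range (\<lambda>a::real. {..a})" by auto
    show "(\<Union>i::nat. {..real i}) = UNIV" using real_arch_simple by auto
    show "emeasure (distr P borel N) {..real i} \<noteq> \<infinity>" for i :: nat by (simp add: 1)
    show "emeasure (distr P borel N) X = emeasure \<nu> X" if "X \<in> range (\<lambda>a::real. {..a})" for X
      using that by (auto simp: 1 2)
  qed
  have "(\<integral>\<^sup>+x. f (N x) \<partial>P) = (\<integral>\<^sup>+r. f r \<partial>distr P borel N)"
    by (subst nn_integral_distr) auto
  also have "\<dots> = (\<integral>\<^sup>+r. ennreal C * (ennreal (g r) * f r) \<partial>lborel)"
    unfolding eq \<nu>_def using C by (subst nn_integral_density) (auto simp: ennreal_mult' mult.assoc)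
  also have "\<dots> = ennreal C * (\<integral>\<^sup>+r. ennreal (g r) * f r \<partial>lborel)"
    by (rule nn_integral_cmult) measurable
  finally show ?thesis by (simp add: N_def P_def C_def g_def n_def)
qed

section \<open>Unnormalized Beta densities and the integral over the last column\<close>

definition beta_kernel :: "real \<Rightarrow> real \<Rightarrow> real \<Rightarrow> real" where
  "beta_kernel a b x = indicator {0..1} x * (x powr (a - 1) * (1 - x) powr (b - 1))"

lemma beta_kernel_measurable [measurable]: "beta_kernel a b \<in> borel_measurable borel"
  unfolding beta_kernel_def by measurable

text \<open>At the end points this rests on the convention \<open>0 powr y = 0\<close> for every y,
  so no condition on the parameters enters.\<close>

lemma beta_kernel_outside: "x \<le> 0 \<or> 1 \<le> x \<Longrightarrow> beta_kernel a b x = 0"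
  by (cases "x = 0"; cases "x = 1") (auto simp: beta_kernel_def indicator_def)

text \<open>The substitution \<open>r = (1 - s) (1 - q)\<close> separates \<open>s\<close> and \<open>q\<close>.\<close>

lemma nn_integral_radial_beta:
  fixes g :: "real \<Rightarrow> ennreal" and a b c s :: real
  assumes g[measurable]: "g \<in> borel_measurable borel"
  shows "(\<integral>\<^sup>+r. ennreal (indicator {0..} r * r powr (c - 1)) *
      (g ((1 - s - r) / (1 - s)) * ennreal (if 0 < s \<and> 0 < 1 - s - r then s powr a * (1 - s - r) powr b else 0)) \<partial>lborel) =
    ennreal (beta_kernel (a + 1) (b + c + 1) s) * (\<integral>\<^sup>+q. g q * ennreal (beta_kernel (b + 1) c q) \<partial>lborel)"
    (is "integral\<^sup>N lborel ?H = _")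
proof (cases "0 < s \<and> s < 1")
  case False
  then have "?H r = 0" for r by (auto simp: indicator_def)
  then have "integral\<^sup>N lborel ?H = (\<integral>\<^sup>+r. 0 \<partial>(lborel :: real measure))" by (rule nn_integral_cong)
  then show ?thesis using False by (simp add: beta_kernel_outside not_less)
next
  case True
  define t where "t = 1 - s"
  have t: "0 < t" using True by (simp add: t_def)
  have H: "?H (t + - t * q) = ennreal (s powr a * t powr (b + c - 1)) * (g q * ennreal (beta_kernel (b + 1) c q))" for q
  proof (cases "0 < q \<and> q < 1")
    case False
    then consider "q \<le> 0" | "1 \<le> q" by linarith
    \<comment> \<open>Each alternative makes the integrand vanish: a negative radius by the
      indicator, radius 0 by \<open>0 powr y = 0\<close>, and the third by the
      \<open>if\<close>.\<close>
    then have "t + - t * q < 0 \<or> t + - t * q = 0 \<or> \<not> 0 < 1 - s - (t + - t * q)"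
    proof cases
      case 1
      then have "t * q \<le> 0" using t by (simp add: mult_nonneg_nonpos)
      moreover have "1 - s - (t + - t * q) = t * q" by (simp add: t_def algebra_simps)
      ultimately show ?thesis by linarith
    next
      case 2
      then have "t \<le> t * q" using t by simp
      then show ?thesis by linarith
    qed
    then have "?H (t + - t * q) = 0" by auto
    then show ?thesis using False by (simp add: beta_kernel_outside not_less)
  next
    case q: True
    define r where "r = t + - t * q"
    have r: "r = t * (1 - q)" "1 - s - r = t * q"
      by (simp_all add: r_def t_def algebra_simps)
    have r0: "0 \<le> r" unfolding r(1) using t q by simp
    have tq: "0 < t * q" "t * q / t = q" using t q by simp_all
    have swap: "ennreal A * (G * ennreal A') = ennreal (A * A') * G" if "0 \<le> A" for A A' G
      unfolding ennreal_mult'[OF that] by (simp add: mult_ac)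
    have 1: "?H r = ennreal (r powr (c - 1)) * (g q * ennreal (s powr a * (t * q) powr b))"
      unfolding r(2) unfolding t_def[symmetric] unfolding tq(2) using r0 tq(1) True by simp
    have 2: "r powr (c - 1) * (s powr a * (t * q) powr b) =
        s powr a * t powr (b + c - 1) * beta_kernel (b + 1) c q"
    proof -
      have "t powr (b + c - 1) = t powr b * t powr (c - 1)"
        using powr_add[of t b "c - 1"] by (simp add: add_diff_eq)
      then show ?thesis unfolding r(1) using t q by (simp add: powr_mult beta_kernel_def)
    qed
    show ?thesis
      unfolding r_def[symmetric] 1 swap[OF powr_ge_zero] 2
      by (rule swap[symmetric]) simp
  qed
  have [measurable]: "?H \<in> borel_measurable borel" by measurable
  have "integral\<^sup>N lborel ?H = ennreal t * (\<integral>\<^sup>+q. ?H (t + - t * q) \<partial>lborel)"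
    using t by (subst nn_integral_real_affine[of ?H "- t" t]) auto
  also have "\<dots> = ennreal t * (ennreal (s powr a * t powr (b + c - 1)) *
      (\<integral>\<^sup>+q. g q * ennreal (beta_kernel (b + 1) c q) \<partial>lborel))"
    unfolding H by (subst nn_integral_cmult) auto
  also have "\<dots> = ennreal (t * (s powr a * t powr (b + c - 1))) *
      (\<integral>\<^sup>+q. g q * ennreal (beta_kernel (b + 1) c q) \<partial>lborel)"
    using t by (simp add: ennreal_mult' mult.assoc)
  also have "t * (s powr a * t powr (b + c - 1)) = beta_kernel (a + 1) (b + c + 1) s"
  proof -
    have "t * t powr (b + c - 1) = t powr (b + c)"
      using t powr_add[of t 1 "b + c - 1"] by simp
    then show ?thesis using True by (simp add: beta_kernel_def t_def[symmetric] mult.left_commute)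
  qed
  finally show ?thesis .
qed

text \<open>The translation of m by \<phi> x removes B from the integrand altogether. For fixed s
  the column then enters only through \<psi> x, so the integral over x becomes one over the radius,
  which separates s from q.\<close>

lemma nn_integral_last_column:
  fixes g1 g2 :: "real \<Rightarrow> ennreal" and e :: "nat \<Rightarrow> 'i" and a b :: real
  assumes n: "1 \<le> n" and Q: "pos_def_mat n Q" and B: "B \<in> carrier_mat n n" and e: "inj_on e {..<n}"
    and g[measurable]: "g1 \<in> borel_measurable borel" "g2 \<in> borel_measurable borel"
  defines "\<phi> \<equiv> \<lambda>x. qform B (vec n (\<lambda>i. x (e i)))" and "\<psi> \<equiv> \<lambda>x. qform Q (vec n (\<lambda>i. x (e i)))"
    and "h \<equiv> \<lambda>s r. g1 s * (g2 ((1 - s - r) / (1 - s)) *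
          ennreal (if 0 < s \<and> 0 < 1 - s - r then s powr a * (1 - s - r) powr b else 0))"
  shows "(\<integral>\<^sup>+x. \<integral>\<^sup>+m. h (m - \<phi> x) (\<psi> x) \<partial>lborel \<partial>(\<Pi>\<^sub>M k\<in>e ` {..<n}. lborel)) =
    ennreal (1 / sqrt (det Q)) * ennreal (unit_ball_vol n * n / 2) *
      (\<integral>\<^sup>+s. g1 s * ennreal (beta_kernel (a + 1) (b + n / 2 + 1) s) \<partial>lborel) *
      (\<integral>\<^sup>+q. g2 q * ennreal (beta_kernel (b + 1) (n / 2) q) \<partial>lborel)"
proof -
  interpret product_sigma_finite "\<lambda>_::'i. lborel :: real measure" by standard
  define P where "P = (\<Pi>\<^sub>M k\<in>e ` {..<n}. (lborel :: real measure))"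
  interpret P: sigma_finite_measure P unfolding P_def by (rule sigma_finite) simp
  interpret PL: pair_sigma_finite P "lborel :: real measure" ..
  have [measurable]: "case_prod h \<in> borel_measurable (borel \<Otimes>\<^sub>M borel)"
    unfolding h_def by measurable
  have hm: "h s \<in> borel_measurable borel" for s
    unfolding h_def by measurable
  have hm': "(\<lambda>s. h s r) \<in> borel_measurable borel" for r
    unfolding h_def by measurable
  have [measurable]: "\<psi> \<in> borel_measurable P"
    unfolding \<psi>_def P_def using Q
    by (intro measurable_qform) (auto simp: pos_def_mat_def symmetric_mat_def)
  define J where "J = (\<integral>\<^sup>+q. g2 q * ennreal (beta_kernel (b + 1) (n / 2) q) \<partial>lborel)"
  define c1 where "c1 = ennreal (1 / sqrt (det Q))"
  define c2 where "c2 = ennreal (unit_ball_vol n * n / 2)"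
  have card: "card (e ` {..<n}) = n" using e by (simp add: card_image)
  have "(\<integral>\<^sup>+m. h (m - \<phi> x) (\<psi> x) \<partial>lborel) = (\<integral>\<^sup>+s. h s (\<psi> x) \<partial>lborel)" for x
    using nn_integral_real_affine[OF hm', of 1 "\<psi> x" "- \<phi> x"] by simp
  then have "(\<integral>\<^sup>+x. \<integral>\<^sup>+m. h (m - \<phi> x) (\<psi> x) \<partial>lborel \<partial>P) = (\<integral>\<^sup>+x. \<integral>\<^sup>+s. h s (\<psi> x) \<partial>lborel \<partial>P)"
    by simp
  \<comment> \<open>With s outermost, \<open>h s\<close> is a function of one real variable, as the
    reduction of the quadratic form requires.\<close>
  also have "\<dots> = (\<integral>\<^sup>+s. \<integral>\<^sup>+x. h s (\<psi> x) \<partial>P \<partial>lborel)"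
    by (rule PL.Fubini'[symmetric]) measurable
  also have "\<dots> = (\<integral>\<^sup>+s. c1 * c2 * (g1 s * ennreal (beta_kernel (a + 1) (b + n / 2 + 1) s) * J) \<partial>lborel)"
  proof (intro nn_integral_cong)
    fix s :: real
    have "(\<integral>\<^sup>+x. h s (\<psi> x) \<partial>P) = c1 * (\<integral>\<^sup>+x. h s (\<Sum>k\<in>e ` {..<n}. (x k)\<^sup>2) \<partial>P)"
      unfolding \<psi>_def P_def c1_def by (rule nn_integral_qform[OF Q e hm])
    also have "(\<integral>\<^sup>+x. h s (\<Sum>k\<in>e ` {..<n}. (x k)\<^sup>2) \<partial>P) =
        c2 * (\<integral>\<^sup>+r. ennreal (indicator {0..} r * r powr (n / 2 - 1)) * h s r \<partial>lborel)"
      unfolding P_def c2_def using n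
      by (subst nn_integral_sum_squares[OF _ _ hm]) (auto simp: card lessThan_empty_iff)
    also have "(\<integral>\<^sup>+r. ennreal (indicator {0..} r * r powr (n / 2 - 1)) * h s r \<partial>lborel) =
        (\<integral>\<^sup>+r. g1 s * (ennreal (indicator {0..} r * r powr (n / 2 - 1)) *
          (g2 ((1 - s - r) / (1 - s)) *
          ennreal (if 0 < s \<and> 0 < 1 - s - r then s powr a * (1 - s - r) powr b else 0))) \<partial>lborel)"
      by (simp add: h_def mult_ac)
    also have "\<dots> = g1 s * (ennreal (beta_kernel (a + 1) (b + n / 2 + 1) s) * J)"
      unfolding J_def nn_integral_radial_beta[OF g(2), symmetric]
      by (rule nn_integral_cmult) measurable
    finally show "(\<integral>\<^sup>+x. h s (\<psi> x) \<partial>P) =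
        c1 * c2 * (g1 s * ennreal (beta_kernel (a + 1) (b + n / 2 + 1) s) * J)"
      by (simp add: mult.assoc)
  qed
  also have "\<dots> = c1 * c2 * (\<integral>\<^sup>+s. g1 s * ennreal (beta_kernel (a + 1) (b + n / 2 + 1) s) \<partial>lborel) * J"
  proof -
    define G where "G s = g1 s * ennreal (beta_kernel (a + 1) (b + n / 2 + 1) s)" for s
    have [measurable]: "G \<in> borel_measurable borel" unfolding G_def by measurable
    have "(\<integral>\<^sup>+s. c1 * c2 * (G s * J) \<partial>lborel) = c1 * c2 * (\<integral>\<^sup>+s. G s \<partial>lborel) * J"
      by (simp add: nn_integral_cmult nn_integral_multc mult.assoc)
    then show ?thesis by (simp add: G_def)
  qed
  finally show ?thesis by (simp add: P_def c1_def c2_def J_def)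
qed

section \<open>Measurability of minors, coordinates and the density\<close>

lemma measurable_det:
  assumes "\<And>x. A x \<in> carrier_mat n n"
    and "\<And>i j. i < n \<Longrightarrow> j < n \<Longrightarrow> (\<lambda>x. A x $$ (i, j)) \<in> borel_measurable M"
  shows "(\<lambda>x. det (A x) :: real) \<in> borel_measurable M"
proof -
  have "p i < n" if "p permutes {0..<n}" "i < n" for p i
    using permutes_in_image[OF that(1), of i] that(2) by simp
  then show ?thesis
    unfolding det_def'[OF assms(1)]
    by (intro borel_measurable_sum borel_measurable_times borel_measurable_const
        borel_measurable_prod assms(2)) simp_all
qed

lemma measurable_minor:
  assumes "upper_index n \<subseteq> I"
  shows "minor n \<in> borel_measurable (\<Pi>\<^sub>M k\<in>I. lborel)"
    and "cominor n \<in> borel_measurable (\<Pi>\<^sub>M k\<in>I. lborel)"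
proof -
  have u: "(\<lambda>u. u (min i j, max i j)) \<in> borel_measurable (\<Pi>\<^sub>M k\<in>I. (lborel :: real measure))"
    if "i < n" "j < n" for i j
  proof -
    have "(min i j, max i j) \<in> I"
      using that by (intro subsetD[OF assms]) (auto simp: upper_index_def)
    from measurable_component_singleton[OF this, of "\<lambda>_. lborel"] show ?thesis by simp
  qed
  show "minor n \<in> borel_measurable (\<Pi>\<^sub>M k\<in>I. lborel)"
    unfolding minor_def
  proof (rule measurable_det)
    fix i j assume ij: "i < n" "j < n"
    then have "(\<lambda>x. sym_mat_of n x $$ (i, j)) = (\<lambda>x. x (min i j, max i j))"
      by (simp add: sym_mat_of_def)
    with u[OF ij] show "(\<lambda>x. sym_mat_of n x $$ (i, j)) \<in> borel_measurable (\<Pi>\<^sub>M k\<in>I. lborel)"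
      by simp
  qed simp
  show "cominor n \<in> borel_measurable (\<Pi>\<^sub>M k\<in>I. lborel)"
    unfolding cominor_def
  proof (rule measurable_det)
    show "1\<^sub>m n - sym_mat_of n x \<in> carrier_mat n n" for x by (simp add: minus_carrier_mat)
    fix i j assume ij: "i < n" "j < n"
    then have "(\<lambda>x. (1\<^sub>m n - sym_mat_of n x) $$ (i, j)) =
        (\<lambda>x. (if i = j then 1 else 0) - x (min i j, max i j))"
      by (simp add: sym_mat_of_def)
    with borel_measurable_diff[OF borel_measurable_const u[OF ij]]
    show "(\<lambda>x. (1\<^sub>m n - sym_mat_of n x) $$ (i, j)) \<in> borel_measurable (\<Pi>\<^sub>M k\<in>I. lborel)"
      by simp
  qed
qed

text \<open>The Schur complement s in the step from order i to order i + 1; it becomes the variable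
  with index (i, 1).\<close>

definition ratio :: "nat \<Rightarrow> (nat \<times> nat \<Rightarrow> real) \<Rightarrow> real" where
  "ratio i u = minor (Suc i) u / minor i u"

text \<open>The quantity q = (1 - s - r) / (1 - s) of the same step, since the quotient of the
  complementary minors is 1 - s - r; it becomes the variable with index (i, 2).\<close>

definition coratio :: "nat \<Rightarrow> (nat \<times> nat \<Rightarrow> real) \<Rightarrow> real" where
  "coratio i u = cominor (Suc i) u / cominor i u / (1 - ratio i u)"

lemma upper_index_mono: "m \<le> n \<Longrightarrow> upper_index m \<subseteq> upper_index n"
  by (auto simp: upper_index_def)

lemma measurable_ratio:
  assumes "i < n"
  shows "ratio i \<in> borel_measurable (upper_lborel n)" and "coratio i \<in> borel_measurable (upper_lborel n)"
proof -
  have [measurable]: "minor (Suc i) \<in> borel_measurable (upper_lborel n)"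
    "minor i \<in> borel_measurable (upper_lborel n)" "cominor (Suc i) \<in> borel_measurable (upper_lborel n)"
    "cominor i \<in> borel_measurable (upper_lborel n)"
    unfolding upper_lborel_def using assms by (auto intro!: measurable_minor upper_index_mono)
  show [measurable]: "ratio i \<in> borel_measurable (upper_lborel n)" unfolding ratio_def by measurable
  show "coratio i \<in> borel_measurable (upper_lborel n)" unfolding coratio_def by measurable
qed

lemma JbetaE_kernel_minors:
  "JbetaE_kernel n \<gamma> \<delta> (sym_mat_of n u) =
    (if \<forall>j\<in>{1..n}. 0 < minor j u \<and> 0 < cominor j u
     then minor n u powr (\<gamma> - (real n + 1) / 2) * cominor n u powr (\<delta> - (real n + 1) / 2) else 0)"
  by (simp add: JbetaE_kernel_def between_0_I_iff_minors_pos minor_def cominor_def)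

lemma measurable_JbetaE_kernel:
  "(\<lambda>u. JbetaE_kernel n \<gamma> \<delta> (sym_mat_of n u)) \<in> borel_measurable (upper_lborel n)"
proof -
  have m: "minor j \<in> borel_measurable (upper_lborel n)" "cominor j \<in> borel_measurable (upper_lborel n)"
    if "j \<le> n" for j
    unfolding upper_lborel_def using that by (auto intro!: measurable_minor upper_index_mono)
  note [measurable] = m[OF order_refl]
  have "Measurable.pred (upper_lborel n) (\<lambda>u. \<forall>j\<in>{1..n}. 0 < minor j u \<and> 0 < cominor j u)"
  proof (intro pred_intros_finite pred_intros_logic)
    fix j assume "j \<in> {1..n}"
    then have [measurable]: "minor j \<in> borel_measurable (upper_lborel n)" "cominor j \<in> borel_measurable (upper_lborel n)"
      by (auto intro!: m)
    show "Measurable.pred (upper_lborel n) (\<lambda>u. 0 < minor j u)" by measurable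
    show "Measurable.pred (upper_lborel n) (\<lambda>u. 0 < cominor j u)" by measurable
  qed simp
  then show ?thesis unfolding JbetaE_kernel_minors by measurable
qed

subsection \<open>Factorization of the density\<close>

text \<open>A test function of product form in the coordinates s and q. Its integrals against the
  density determine the joint law, and the product form makes the induction on the order possible.
  The second product starts at 1 because the step from order 0 has an empty column.\<close>

definition coord_prod :: "nat \<Rightarrow> (nat \<Rightarrow> real \<Rightarrow> ennreal) \<Rightarrow> (nat \<Rightarrow> real \<Rightarrow> ennreal) \<Rightarrow> (nat \<times> nat \<Rightarrow> real) \<Rightarrow> ennreal" where
  "coord_prod n f g u = (\<Prod>i<n. f i (ratio i u)) * (\<Prod>i\<in>{1..<n}. g i (coratio i u))"

lemma coord_prod_Suc:
  "1 \<le> n \<Longrightarrow> coord_prod (Suc n) f g u = coord_prod n f g u * (f n (ratio n u) * g n (coratio n u))"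
  by (simp add: coord_prod_def prod.atLeastLessThan_Suc mult_ac)

lemma measurable_coord_prod:
  assumes f[measurable]: "\<And>i. f i \<in> borel_measurable borel" and g[measurable]: "\<And>i. g i \<in> borel_measurable borel"
  shows "coord_prod n f g \<in> borel_measurable (upper_lborel n)"
  unfolding coord_prod_def
  by (intro borel_measurable_times_ennreal borel_measurable_prod_ennreal
      measurable_compose[OF _ f] measurable_compose[OF _ g] measurable_ratio) auto

lemma minor_cong:
  assumes "\<And>ij. ij \<in> upper_index n \<Longrightarrow> u ij = w ij" "j \<le> n"
  shows "minor j w = minor j u" "cominor j w = cominor j u"
proof -
  have "sym_mat_of j u = sym_mat_of j w"
    using assms upper_index_mono[of j n] by (intro sym_mat_of_cong) blast
  then show "minor j w = minor j u" "cominor j w = cominor j u"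
    by (simp_all add: minor_def cominor_def)
qed

lemma coord_prod_cong:
  assumes "\<And>ij. ij \<in> upper_index n \<Longrightarrow> u ij = w ij"
  shows "coord_prod n f g w = coord_prod n f g u"
proof -
  note c = minor_cong[of n u w, OF assms]
  have "ratio i w = ratio i u" "coratio i w = coratio i u" if "i < n" for i
    using that by (simp_all add: ratio_def coratio_def c)
  then show ?thesis by (simp add: coord_prod_def)
qed

text \<open>For a fixed block of order n, the integrand of order n + 1 is a constant k times a
  function h of s and r only. Integrating h over the last column leaves k / sqrt (det Q), which is
  the integrand of order n, times constants and one-dimensional integrals free of the block.\<close>

lemma nn_integral_coord_prod_Suc:
  assumes n: "1 \<le> n"
    and f[measurable]: "\<And>i. f i \<in> borel_measurable borel" and g[measurable]: "\<And>i. g i \<in> borel_measurable borel"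
  shows "(\<integral>\<^sup>+u. coord_prod (Suc n) f g u * ennreal (JbetaE_kernel (Suc n) \<gamma> \<delta> (sym_mat_of (Suc n) u)) \<partial>upper_lborel (Suc n)) =
    (\<integral>\<^sup>+u. coord_prod n f g u * ennreal (JbetaE_kernel n \<gamma> \<delta> (sym_mat_of n u)) \<partial>upper_lborel n) *
    (ennreal (unit_ball_vol n * n / 2) *
      (\<integral>\<^sup>+x. f n x * ennreal (beta_kernel (\<gamma> - n / 2) \<delta> x) \<partial>lborel) *
      (\<integral>\<^sup>+x. g n x * ennreal (beta_kernel (\<delta> - n / 2) (n / 2) x) \<partial>lborel))"
    (is "integral\<^sup>N _ ?G = integral\<^sup>N _ ?L * ?R")
proof -
  interpret product_sigma_finite "\<lambda>_::nat \<times> nat. lborel :: real measure" by standard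
  define e where "e i = (i, n)" for i :: nat
  define U where "U = upper_index n"
  define J where "J = e ` {..<n}"
  have e: "inj_on e {..<n}" by (simp add: e_def inj_on_def)
  have finU: "finite U"
    unfolding U_def upper_index_def by (rule finite_subset[of _ "{..<n} \<times> {..<n}"]) auto
  \<comment> \<open>The new positions are the corner (n, n) and the column J above it.\<close>
  have idx: "upper_index (Suc n) = U \<union> insert (n, n) J" "U \<inter> insert (n, n) J = {}" "finite J" "(n, n) \<notin> J"
    by (auto simp: upper_index_def U_def J_def e_def less_Suc_eq)
  have Gm: "?G \<in> borel_measurable (upper_lborel (Suc n))"
    by (intro borel_measurable_times_ennreal measurable_coord_prod[OF f g]
        measurable_compose[OF _ measurable_ennreal] measurable_JbetaE_kernel)
  then have Gm': "?G \<in> borel_measurable (Pi\<^sub>M (U \<union> insert (n, n) J) (\<lambda>_. lborel))"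
    by (simp add: upper_lborel_def idx(1))
  define a where "a = \<gamma> - (real (Suc n) + 1) / 2"
  define b where "b = \<delta> - (real (Suc n) + 1) / 2"
  have inner: "(\<integral>\<^sup>+y. ?G (merge U (insert (n, n) J) (u, y)) \<partial>Pi\<^sub>M (insert (n, n) J) (\<lambda>_. lborel)) = ?L u * ?R"
    if u: "u \<in> space (Pi\<^sub>M U (\<lambda>_. lborel))" for u
  proof -
    \<comment> \<open>The point with block u, column x and corner m. The corner is written as an
      update so that m is integrated innermost, with the column fixed; this is the order in which
      the translation by \<phi> x applies.\<close>
    define w where "w x m = merge U (insert (n, n) J) (u, x((n, n) := m))" for x m
    have w1: "u ij = w x m ij" if "ij \<in> upper_index n" for x m ij
      using that by (auto simp: w_def merge_def U_def)
    have w2: "w x m (n, n) = m" "i < n \<Longrightarrow> w x m (i, n) = x (e i)" for x m i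
      using idx(2) by (auto simp: w_def merge_def U_def upper_index_def J_def e_def)
    have wc: "minor j (w x m) = minor j u" "cominor j (w x m) = cominor j u" if "j \<le> n" for j x m
      using minor_cong[of n u "w x m" j] w1 that by blast+
    have cw: "coord_prod n f g (w x m) = coord_prod n f g u" for x m
      using coord_prod_cong[of n u "w x m"] w1 by blast
    have "(\<lambda>y. ?G (merge U (insert (n, n) J) (u, y))) \<in> borel_measurable (Pi\<^sub>M (insert (n, n) J) (\<lambda>_. lborel))"
      by (rule measurable_compose[OF _ Gm'], rule measurable_compose[OF _ measurable_merge])
        (use u in \<open>auto intro!: measurable_Pair\<close>)
    then have 1: "(\<integral>\<^sup>+y. ?G (merge U (insert (n, n) J) (u, y)) \<partial>Pi\<^sub>M (insert (n, n) J) (\<lambda>_. lborel)) =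
        (\<integral>\<^sup>+x. \<integral>\<^sup>+m. ?G (w x m) \<partial>lborel \<partial>Pi\<^sub>M J (\<lambda>_. lborel))"
      unfolding w_def by (intro product_nn_integral_insert idx(3,4))
    show ?thesis
    proof (cases "\<forall>j\<in>{1..n}. 0 < minor j u \<and> 0 < cominor j u")
      \<comment> \<open>Outside the domain of order n both kernels vanish, since minors of order at
        most n agree at \<open>w x m\<close> and u.\<close>
      case False
      then obtain j where j: "j \<in> {1..n}" "\<not> (0 < minor j u \<and> 0 < cominor j u)" by blast
      have "\<not> (\<forall>j\<in>{1..Suc n}. 0 < minor j (w x m) \<and> 0 < cominor j (w x m))" for x m
      proof
        assume "\<forall>j\<in>{1..Suc n}. 0 < minor j (w x m) \<and> 0 < cominor j (w x m)"
        then have "0 < minor j (w x m) \<and> 0 < cominor j (w x m)" using j(1) by auto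
        then show False using j by (simp add: wc)
      qed
      then have "JbetaE_kernel (Suc n) \<gamma> \<delta> (sym_mat_of (Suc n) (w x m)) = 0" for x m unfolding JbetaE_kernel_minors by (subst if_not_P) auto
      moreover have "JbetaE_kernel n \<gamma> \<delta> (sym_mat_of n u) = 0" using False unfolding JbetaE_kernel_minors by (subst if_not_P) auto
      ultimately show ?thesis unfolding 1 by simp
    next
      case True
      define D where "D = minor n u"
      define E where "E = cominor n u"
      have DE: "0 < D" "0 < E" using True n by (auto simp: D_def E_def)
      obtain B Q where B: "B \<in> carrier_mat n n" and Q: "pos_def_mat n Q" and det: "D * E * det Q = 1"
        and mS: "\<And>w. (\<And>ij. ij \<in> upper_index n \<Longrightarrow> u ij = w ij) \<Longrightarrow>
          minor (Suc n) w = D * (w (n, n) - qform B (vec n (\<lambda>i. w (i, n))))"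
        and cS: "\<And>w. (\<And>ij. ij \<in> upper_index n \<Longrightarrow> u ij = w ij) \<Longrightarrow>
          cominor (Suc n) w = E * (1 - w (n, n) -
            (qform Q (vec n (\<lambda>i. w (i, n))) - qform B (vec n (\<lambda>i. w (i, n)))))"
        using True unfolding D_def E_def between_0_I_iff_minors_pos[symmetric]
        by (rule minors_Suc) blast
      define \<phi> where "\<phi> x = qform B (vec n (\<lambda>i. x (e i)))" for x :: "nat \<times> nat \<Rightarrow> real"
      define \<psi> where "\<psi> x = qform Q (vec n (\<lambda>i. x (e i)))" for x :: "nat \<times> nat \<Rightarrow> real"
      have vw: "vec n (\<lambda>i. w x m (i, n)) = vec n (\<lambda>i. x (e i))" for x m
        by (intro eq_vecI) (auto simp: w2)
      have S1: "minor (Suc n) (w x m) = D * (m - \<phi> x)"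
        and S2: "cominor (Suc n) (w x m) = E * (1 - (m - \<phi> x) - \<psi> x)" for x m
        using mS[of "w x m"] cS[of "w x m"] w1 by (simp_all add: vw w2(1) \<phi>_def \<psi>_def)
      have r: "ratio n (w x m) = m - \<phi> x"
        "coratio n (w x m) = (1 - (m - \<phi> x) - \<psi> x) / (1 - (m - \<phi> x))" for x m
        using DE unfolding coratio_def ratio_def S1 S2 wc[OF order_refl] D_def E_def by simp_all
      have K: "JbetaE_kernel (Suc n) \<gamma> \<delta> (sym_mat_of (Suc n) (w x m)) =
          D powr a * E powr b * (if 0 < m - \<phi> x \<and> 0 < 1 - (m - \<phi> x) - \<psi> x
            then (m - \<phi> x) powr a * (1 - (m - \<phi> x) - \<psi> x) powr b else 0)" for x m
      proof -
        have "(\<forall>j\<in>{1..Suc n}. 0 < minor j (w x m) \<and> 0 < cominor j (w x m)) \<longleftrightarrow>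
            0 < m - \<phi> x \<and> 0 < 1 - (m - \<phi> x) - \<psi> x"
          using True DE by (auto simp: atLeastAtMostSuc_conv S1 S2 wc zero_less_mult_iff)
        then show ?thesis
          unfolding JbetaE_kernel_minors S1 S2 a_def[symmetric] b_def[symmetric]
          using DE by (simp add: powr_mult mult_ac)
      qed
      define h where "h s r = f n s * (g n ((1 - s - r) / (1 - s)) *
          ennreal (if 0 < s \<and> 0 < 1 - s - r then s powr a * (1 - s - r) powr b else 0))" for s r
      \<comment> \<open>Everything that depends on the block alone, including the powers of its two
        determinants that the kernel of order n + 1 contributes.\<close>
      define k where "k = coord_prod n f g u * ennreal (D powr a * E powr b)"
      have G: "?G (w x m) = k * h (m - \<phi> x) (\<psi> x)" for x m
        unfolding coord_prod_Suc[OF n] K r cw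
        by (subst ennreal_mult') (auto simp: h_def k_def mult_ac)
      have [measurable]: "\<phi> \<in> borel_measurable (Pi\<^sub>M J (\<lambda>_. lborel))" "\<psi> \<in> borel_measurable (Pi\<^sub>M J (\<lambda>_. lborel))"
        unfolding \<phi>_def \<psi>_def using B Q
        by (auto intro!: measurable_qform simp: J_def pos_def_mat_def symmetric_mat_def)
      have [measurable]: "case_prod h \<in> borel_measurable (borel \<Otimes>\<^sub>M borel)" unfolding h_def by measurable
      have "(\<integral>\<^sup>+x. \<integral>\<^sup>+m. ?G (w x m) \<partial>lborel \<partial>Pi\<^sub>M J (\<lambda>_. lborel)) =
          k * (\<integral>\<^sup>+x. \<integral>\<^sup>+m. h (m - \<phi> x) (\<psi> x) \<partial>lborel \<partial>Pi\<^sub>M J (\<lambda>_. lborel))"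
        unfolding G by (subst nn_integral_cmult[symmetric], measurable)
          (intro nn_integral_cong nn_integral_cmult, measurable)
      also have "(\<integral>\<^sup>+x. \<integral>\<^sup>+m. h (m - \<phi> x) (\<psi> x) \<partial>lborel \<partial>Pi\<^sub>M J (\<lambda>_. lborel)) =
          ennreal (1 / sqrt (det Q)) * ennreal (unit_ball_vol n * n / 2) *
          (\<integral>\<^sup>+x. f n x * ennreal (beta_kernel (a + 1) (b + n / 2 + 1) x) \<partial>lborel) *
          (\<integral>\<^sup>+x. g n x * ennreal (beta_kernel (b + 1) (n / 2) x) \<partial>lborel)"
        unfolding h_def \<phi>_def \<psi>_def J_def
        by (rule nn_integral_last_column[OF n Q B e f g])
      also have "a + 1 = \<gamma> - n / 2" by (simp add: a_def field_simps)
      also have "b + n / 2 + 1 = \<delta>" by (simp add: b_def field_simps)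
      also have "b + 1 = \<delta> - n / 2" by (simp add: b_def field_simps)
      finally have 2: "(\<integral>\<^sup>+x. \<integral>\<^sup>+m. ?G (w x m) \<partial>lborel \<partial>Pi\<^sub>M J (\<lambda>_. lborel)) =
          (k * ennreal (1 / sqrt (det Q))) * ?R" by (simp add: mult.assoc)
      \<comment> \<open>Since D * E * det Q = 1, the factor 1 / sqrt (det Q) is sqrt (D * E). It
        adds 1 / 2 to both exponents and so produces those of order n.\<close>
      have "D powr a * E powr b * (1 / sqrt (det Q)) =
          D powr (\<gamma> - (real n + 1) / 2) * E powr (\<delta> - (real n + 1) / 2)"
      proof -
        have "1 / sqrt (det Q) = sqrt (D * E)"
        proof -
          have "det Q = 1 / (D * E)" using det DE by (simp add: field_simps)
          then show ?thesis by (simp add: real_sqrt_divide)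
        qed
        also have "\<dots> = D powr (1 / 2) * E powr (1 / 2)"
          using DE by (simp add: real_sqrt_mult powr_half_sqrt)
        finally have "D powr a * E powr b * (1 / sqrt (det Q)) = D powr (a + 1 / 2) * E powr (b + 1 / 2)"
          by (simp add: powr_add)
        also have "a + 1 / 2 = \<gamma> - (real n + 1) / 2" by (simp add: a_def field_simps)
        also have "b + 1 / 2 = \<delta> - (real n + 1) / 2" by (simp add: b_def field_simps)
        finally show ?thesis .
      qed
      then have "k * ennreal (1 / sqrt (det Q)) = ?L u"
        using True by (simp add: k_def JbetaE_kernel_minors D_def E_def mult.assoc ennreal_mult'[symmetric])
      with 1 2 show ?thesis by simp
    qed
  qed
  have "integral\<^sup>N (upper_lborel (Suc n)) ?G =
      (\<integral>\<^sup>+u. \<integral>\<^sup>+y. ?G (merge U (insert (n, n) J) (u, y)) \<partial>Pi\<^sub>M (insert (n, n) J) (\<lambda>_. lborel) \<partial>Pi\<^sub>M U (\<lambda>_. lborel))"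
    unfolding upper_lborel_def idx(1) using idx finU Gm'
    by (intro product_nn_integral_fold) auto
  also have "\<dots> = (\<integral>\<^sup>+u. ?L u * ?R \<partial>Pi\<^sub>M U (\<lambda>_. lborel))"
    by (intro nn_integral_cong inner)
  also have "\<dots> = integral\<^sup>N (upper_lborel n) ?L * ?R"
    unfolding U_def upper_lborel_def[symmetric]
    by (intro nn_integral_multc borel_measurable_times_ennreal measurable_coord_prod[OF f g]
        measurable_compose[OF _ measurable_ennreal] measurable_JbetaE_kernel)
  finally show ?thesis .
qed

section \<open>The factorization for every order, starting from order 1\<close>

lemma minor_1: "minor (Suc 0) u = u (0, 0)"
  by (simp add: minor_def sym_mat_of_def det_single)

lemma cominor_1: "cominor (Suc 0) u = 1 - u (0, 0)"
  by (simp add: cominor_eq_minor minor_1 co_entries_def)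

lemma nn_integral_coord_prod_1:
  assumes f[measurable]: "\<And>i. f i \<in> borel_measurable borel"
  shows "(\<integral>\<^sup>+u. coord_prod 1 f g u * ennreal (JbetaE_kernel 1 \<gamma> \<delta> (sym_mat_of 1 u)) \<partial>upper_lborel 1) =
    (\<integral>\<^sup>+x. f 0 x * ennreal (beta_kernel \<gamma> \<delta> x) \<partial>lborel)"
proof -
  interpret product_sigma_finite "\<lambda>_::nat \<times> nat. lborel :: real measure" by standard
  have U: "upper_index 1 = {(0, 0)}" by (auto simp: upper_index_def)
  have K: "JbetaE_kernel 1 \<gamma> \<delta> (sym_mat_of 1 u) = beta_kernel \<gamma> \<delta> (u (0, 0))" for u
    unfolding JbetaE_kernel_minors
    by (cases "0 < u (0, 0) \<and> u (0, 0) < 1") (auto simp: minor_1 cominor_1 beta_kernel_outside not_less, simp add: beta_kernel_def)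
  have r: "ratio 0 u = u (0, 0)" for u by (simp add: ratio_def minor_1)
  have "(\<integral>\<^sup>+u. coord_prod 1 f g u * ennreal (JbetaE_kernel 1 \<gamma> \<delta> (sym_mat_of 1 u)) \<partial>upper_lborel 1) =
      (\<integral>\<^sup>+u. f 0 (u (0, 0)) * ennreal (beta_kernel \<gamma> \<delta> (u (0, 0))) \<partial>(\<Pi>\<^sub>M k\<in>{(0 :: nat, 0 :: nat)}. lborel))"
    unfolding K upper_lborel_def U by (simp add: coord_prod_def r)
  also have "\<dots> = (\<integral>\<^sup>+x. f 0 x * ennreal (beta_kernel \<gamma> \<delta> x) \<partial>lborel)"
    by (rule product_nn_integral_singleton) measurable
  finally show ?thesis .
qed

text \<open>The constant is quantified before the test functions. This uniformity gives
  independence, and it lets the constant be fixed later by a single choice of f and g.\<close>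

lemma nn_integral_coord_prod:
  assumes "1 \<le> n"
  shows "\<exists>C>0. \<forall>f g. (\<forall>i. f i \<in> borel_measurable borel) \<longrightarrow> (\<forall>i. g i \<in> borel_measurable borel) \<longrightarrow>
    (\<integral>\<^sup>+u. coord_prod n f g u * ennreal (JbetaE_kernel n \<gamma> \<delta> (sym_mat_of n u)) \<partial>upper_lborel n) =
    ennreal C * ((\<Prod>i<n. \<integral>\<^sup>+x. f i x * ennreal (beta_kernel (\<gamma> - i / 2) \<delta> x) \<partial>lborel) *
      (\<Prod>i\<in>{1..<n}. \<integral>\<^sup>+x. g i x * ennreal (beta_kernel (\<delta> - i / 2) (i / 2) x) \<partial>lborel))"
  using assms
proof (induction n rule: dec_induct)
  case base
  show ?case by (intro exI[of _ 1]) (simp add: nn_integral_coord_prod_1[unfolded One_nat_def])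
next
  case (step n)
  then obtain C where C: "0 < C" and IH: "\<And>f g. (\<forall>i. f i \<in> borel_measurable borel) \<Longrightarrow> (\<forall>i. g i \<in> borel_measurable borel) \<Longrightarrow>
    (\<integral>\<^sup>+u. coord_prod n f g u * ennreal (JbetaE_kernel n \<gamma> \<delta> (sym_mat_of n u)) \<partial>upper_lborel n) =
    ennreal C * ((\<Prod>i<n. \<integral>\<^sup>+x. f i x * ennreal (beta_kernel (\<gamma> - i / 2) \<delta> x) \<partial>lborel) *
      (\<Prod>i\<in>{1..<n}. \<integral>\<^sup>+x. g i x * ennreal (beta_kernel (\<delta> - i / 2) (i / 2) x) \<partial>lborel))"
    by blast
  define c where "c = unit_ball_vol n * n / 2"
  have c: "0 < c" using step by (simp add: c_def)
  show ?case
  proof (intro exI[of _ "C * c"] conjI allI impI)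
    \<comment> \<open>The step of order n multiplies the constant by c, the constant of the radial
      density in dimension n.\<close>
    show "0 < C * c" using C c by simp
    fix f g :: "nat \<Rightarrow> real \<Rightarrow> ennreal"
    assume m: "\<forall>i. f i \<in> borel_measurable borel" "\<forall>i. g i \<in> borel_measurable borel"
    show "(\<integral>\<^sup>+u. coord_prod (Suc n) f g u * ennreal (JbetaE_kernel (Suc n) \<gamma> \<delta> (sym_mat_of (Suc n) u)) \<partial>upper_lborel (Suc n)) =
      ennreal (C * c) * ((\<Prod>i<Suc n. \<integral>\<^sup>+x. f i x * ennreal (beta_kernel (\<gamma> - i / 2) \<delta> x) \<partial>lborel) *
      (\<Prod>i\<in>{1..<Suc n}. \<integral>\<^sup>+x. g i x * ennreal (beta_kernel (\<delta> - i / 2) (i / 2) x) \<partial>lborel))"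
      using nn_integral_coord_prod_Suc[of n f g \<gamma> \<delta>, folded c_def] step(1) m C c
      by (simp add: IH prod.atLeastLessThan_Suc ennreal_mult mult_ac)
  qed
qed

subsection \<open>Independence of the coordinates\<close>

lemma nn_integral_beta_density:
  assumes "0 < a" "0 < b"
  shows "(\<integral>\<^sup>+x. ennreal (beta_density a b x) \<partial>lborel) = 1"
proof -
  have B: "0 < Beta a b" using assms by (simp add: Beta_def)
  have "((\<lambda>t. t powr (a - 1) * (1 - t) powr (b - 1) / Beta a b) has_integral Beta a b / Beta a b) {0..1}"
    by (rule has_integral_divide[OF has_integral_Beta_real[OF assms]])
  then have hi: "((\<lambda>t. t powr (a - 1) * (1 - t) powr (b - 1) / Beta a b) has_integral 1) {0..1}"
    using B by simp
  have "(\<integral>\<^sup>+x. ennreal (indicator {0..1} x * (x powr (a - 1) * (1 - x) powr (b - 1) / Beta a b)) \<partial>lborel) = ennreal 1"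
    by (rule nn_integral_has_integral_lebesgue[OF _ hi]) (use B in auto)
  moreover have "beta_density a b x = indicator {0..1} x * (x powr (a - 1) * (1 - x) powr (b - 1) / Beta a b)" for x
    by (simp add: beta_density_def indicator_def)
  ultimately show ?thesis by simp
qed

lemma beta_density_measurable [measurable]: "beta_density a b \<in> borel_measurable borel"
  unfolding beta_density_def by measurable

lemma nn_integral_beta_kernel:
  assumes "0 < a" "0 < b" and [measurable]: "f \<in> borel_measurable borel"
  shows "(\<integral>\<^sup>+x. f x * ennreal (beta_kernel a b x) \<partial>lborel) =
    ennreal (Beta a b) * (\<integral>\<^sup>+x. f x * ennreal (beta_density a b x) \<partial>lborel)"
proof -
  have B: "0 < Beta a b" using assms by (simp add: Beta_def)
  have "beta_kernel a b x = Beta a b * beta_density a b x" for x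
    using B by (simp add: beta_kernel_def beta_density_def indicator_def)
  then have "f x * ennreal (beta_kernel a b x) = ennreal (Beta a b) * (f x * ennreal (beta_density a b x))" for x
    using B by (simp add: ennreal_mult' mult.left_commute)
  then show ?thesis by (simp add: nn_integral_cmult)
qed

text \<open>Taking \<open>A k = UNIV\<close> at every index but one gives the marginals. With these
  known, the hypothesis says that the joint law agrees on boxes with the product of the marginals,
  which is independence.\<close>

lemma (in prob_space) indep_vars_of_product_law:
  fixes Y :: "'i \<Rightarrow> 'a \<Rightarrow> real" and \<nu> :: "'i \<Rightarrow> real measure"
  assumes J: "finite J" "J \<noteq> {}" and Y: "\<And>j. j \<in> J \<Longrightarrow> Y j \<in> borel_measurable M"
    and \<nu>: "\<And>j. j \<in> J \<Longrightarrow> prob_space (\<nu> j)" "\<And>j. j \<in> J \<Longrightarrow> sets (\<nu> j) = sets borel"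
    and law: "\<And>A. (\<And>j. A j \<in> sets borel) \<Longrightarrow>
      (\<integral>\<^sup>+\<omega>. (\<Prod>j\<in>J. indicator (A j) (Y j \<omega>)) \<partial>M) = (\<Prod>j\<in>J. emeasure (\<nu> j) (A j))"
  shows "indep_vars (\<lambda>_. borel) Y J" and "\<And>j. j \<in> J \<Longrightarrow> distr M borel (Y j) = \<nu> j"
proof -
  show marg: "distr M borel (Y j) = \<nu> j" if j: "j \<in> J" for j
  proof (rule measure_eqI)
    show "sets (distr M borel (Y j)) = sets (\<nu> j)" using \<nu>(2)[OF j] by simp
    fix B assume "B \<in> sets (distr M borel (Y j))"
    then have B: "B \<in> sets borel" by simp
    define A where "A k = (if k = j then B else UNIV)" for k
    have A: "A k \<in> sets borel" for k using B by (simp add: A_def)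
    have [measurable]: "Y j \<in> borel_measurable M" by (rule Y[OF j])
    have "emeasure (distr M borel (Y j)) B = (\<integral>\<^sup>+x. indicator B x \<partial>distr M borel (Y j))"
      using B by simp
    also have "\<dots> = (\<integral>\<^sup>+\<omega>. indicator B (Y j \<omega>) \<partial>M)"
      using B by (intro nn_integral_distr) auto
    also have "\<dots> = (\<integral>\<^sup>+\<omega>. (\<Prod>k\<in>J. indicator (A k) (Y k \<omega>)) \<partial>M)"
      using J j by (intro nn_integral_cong)
        (simp add: A_def prod.remove[of J j] if_distrib[of "\<lambda>A. indicator A _"] cong: if_cong)
    also have "\<dots> = (\<Prod>k\<in>J. emeasure (\<nu> k) (A k))" by (rule law[OF A])
    also have "\<dots> = (\<Prod>k\<in>J. if k = j then emeasure (\<nu> j) B else 1)"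
    proof (intro prod.cong refl)
      fix k assume k: "k \<in> J"
      have "space (\<nu> k) = UNIV" using sets_eq_imp_space_eq[OF \<nu>(2)[OF k]] by simp
      then show "emeasure (\<nu> k) (A k) = (if k = j then emeasure (\<nu> j) B else 1)"
        using prob_space.emeasure_space_1[OF \<nu>(1)[OF k]] by (simp add: A_def)
    qed
    also have "\<dots> = emeasure (\<nu> j) B" using J j by simp
    finally show "emeasure (distr M borel (Y j)) B = emeasure (\<nu> j) B" .
  qed
  \<comment> \<open>The product locale asks for a probability measure at every index; outside J a
    point mass serves as default.\<close>
  define \<nu>' where "\<nu>' j = (if j \<in> J then \<nu> j else return borel 0)" for j
  have "prob_space (\<nu>' j)" for j
    using \<nu>(1) by (simp add: \<nu>'_def prob_space_return)
  then interpret PP: product_prob_space \<nu>' J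
    by (simp add: product_prob_space_def product_prob_space_axioms_def product_sigma_finite_def
        prob_space_imp_sigma_finite)
  have \<nu>'s: "sets (\<nu>' j) = sets borel" for j using \<nu>(2) by (simp add: \<nu>'_def)
  let ?T = "\<lambda>x. \<lambda>i\<in>J. Y i x"
  let ?D = "distr M (\<Pi>\<^sub>M i\<in>J. borel) ?T"
  have T: "?T \<in> measurable M (\<Pi>\<^sub>M i\<in>J. borel)" using Y by (intro measurable_restrict) auto
  have "?D = Pi\<^sub>M J \<nu>'"
  proof (rule PP.PiM_eqI[OF J(1)])
    show "sets ?D = sets (Pi\<^sub>M J \<nu>')"
      unfolding sets_distr by (intro sets_PiM_cong refl) (simp add: \<nu>'s)
    fix A :: "'i \<Rightarrow> real set" assume "\<And>i. i \<in> J \<Longrightarrow> A i \<in> sets (\<nu>' i)"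
    then have A: "\<And>i. i \<in> J \<Longrightarrow> A i \<in> sets borel" by (simp add: \<nu>'s)
    \<comment> \<open>The hypothesis \<open>law\<close> speaks of families measurable at all
      indices, whereas a box constrains only those in J.\<close>
    define A' where "A' i = (if i \<in> J then A i else UNIV)" for i
    have A': "A' i \<in> sets borel" for i using A by (simp add: A'_def)
    have S: "Pi\<^sub>E J A \<in> sets (\<Pi>\<^sub>M i\<in>J. borel)" using A J by (intro sets_PiM_I_finite) auto
    have "emeasure ?D (Pi\<^sub>E J A) = (\<integral>\<^sup>+x. indicator (Pi\<^sub>E J A) x \<partial>?D)" using S by simp
    also have "\<dots> = (\<integral>\<^sup>+\<omega>. indicator (Pi\<^sub>E J A) (?T \<omega>) \<partial>M)"
      using S by (intro nn_integral_distr[OF T]) auto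
    also have "\<dots> = (\<integral>\<^sup>+\<omega>. (\<Prod>j\<in>J. indicator (A' j) (Y j \<omega>)) \<partial>M)"
    proof (intro nn_integral_cong)
      fix \<omega>
      show "(indicator (Pi\<^sub>E J A) (?T \<omega>) :: ennreal) = (\<Prod>j\<in>J. indicator (A' j) (Y j \<omega>))"
      proof (cases "\<forall>j\<in>J. Y j \<omega> \<in> A j")
        case True
        then show ?thesis by (simp add: A'_def PiE_iff)
      next
        case False
        then obtain j where "j \<in> J" "Y j \<omega> \<notin> A j" by blast
        then have "(\<Prod>j\<in>J. indicator (A' j) (Y j \<omega>) :: ennreal) = 0"
          using J by (intro prod_zero) (auto simp: A'_def intro!: bexI[of _ j])
        then show ?thesis using False by (auto simp: PiE_iff indicator_def)
      qed
    qed
    also have "\<dots> = (\<Prod>j\<in>J. emeasure (\<nu> j) (A' j))" by (rule law[OF A'])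
    also have "\<dots> = (\<Prod>j\<in>J. emeasure (\<nu>' j) (A j))" by (simp add: A'_def \<nu>'_def)
    finally show "emeasure ?D (Pi\<^sub>E J A) = (\<Prod>j\<in>J. emeasure (\<nu>' j) (A j))" .
  qed
  also have "\<dots> = (\<Pi>\<^sub>M i\<in>J. distr M borel (Y i))"
    by (intro PiM_cong refl) (simp add: \<nu>'_def marg)
  finally show "indep_vars (\<lambda>_. borel) Y J"
    using indep_vars_iff_distr_eq_PiM'[OF J(2), where M' = "\<lambda>_. borel" and X = Y] Y by simp
qed

lemma prod_coordinates:
  fixes h :: "nat \<times> nat \<Rightarrow> 'b :: comm_monoid_mult"
  shows "(\<Prod>j\<in>{0..<p} \<times> {1} \<union> {1..<p} \<times> {2}. h j) = (\<Prod>i<p. h (i, 1)) * (\<Prod>i\<in>{1..<p}. h (i, 2))"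
proof -
  have "prod h ({0..<p} \<times> {1} \<union> {1..<p} \<times> {2}) = prod h ({0..<p} \<times> {1}) * prod h ({1..<p} \<times> {2})"
    by (intro prod.union_disjoint) auto
  moreover have "prod h (A \<times> {k}) = (\<Prod>i\<in>A. h (i, k))" for A k
    using prod.reindex[of "\<lambda>i. (i, k)" A h] by (simp add: inj_on_def Times_insert_right)
  ultimately show ?thesis by (simp add: atLeast0LessThan)
qed

section \<open>Upper left blocks in terms of the entries\<close>

lemma pick_lessThan: "i < j \<Longrightarrow> pick {..<j} i = i"
proof (induction i)
  case 0
  then show ?case by (auto intro!: Least_equality)
next
  case (Suc i)
  then have "pick {..<j} i = i" by simp
  with Suc.prems show ?case by (auto intro!: Least_equality)
qed

lemma upper_left_eq:
  assumes "A \<in> carrier_mat p p" "j \<le> p"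
  shows "upper_left A j = mat j j (\<lambda>ij. A $$ ij)"
proof -
  have "{i. i < p \<and> i \<in> {..<j}} = {..<j}" using assms by auto
  then have "card {i. i < dim_row A \<and> i \<in> {..<j}} = j" "card {i. i < dim_col A \<and> i \<in> {..<j}} = j"
    using assms by auto
  then show ?thesis
    unfolding upper_left_def submatrix_def by (intro eq_matI) (auto simp: pick_lessThan)
qed

lemma sym_mat_of_upper_entries:
  assumes "symmetric_mat p A"
  shows "sym_mat_of p (upper_entries p A) = A"
  by (subst (2) symmetric_mat_eq_sym_mat_of[OF assms], rule sym_mat_of_cong) (simp add: upper_entries_def)

lemma upper_left_sym_mat_of:
  assumes "symmetric_mat p A" "j \<le> p"
  shows "upper_left A j = sym_mat_of j (upper_entries p A)"
proof -
  have "upper_left A j = mat j j (\<lambda>ij. sym_mat_of p (upper_entries p A) $$ ij)"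
    using assms by (subst upper_left_eq[of _ p]) (auto simp: sym_mat_of_upper_entries symmetric_mat_def)
  also have "\<dots> = sym_mat_of j (upper_entries p A)"
    using assms by (intro eq_matI) (auto simp: sym_mat_of_def)
  finally show ?thesis .
qed

section \<open>Bounds and identities at a single point of the support\<close>

context
  fixes p :: nat and u :: "nat \<times> nat \<Rightarrow> real"
  assumes between: "between_0_I p (sym_mat_of p u)"
begin

lemma minors_pos: "j \<le> p \<Longrightarrow> 0 < minor j u" "j \<le> p \<Longrightarrow> 0 < cominor j u"
  using between by (cases "j = 0"; simp add: between_0_I_iff_minors_pos)+

text \<open>The upper bound holds because the complementary quotient 1 - s - r is positive and r, a
  value of the positive definite form Q, is nonnegative.\<close>

lemma ratio_bounds:
  assumes i: "i < p"
  shows "0 < ratio i u" "ratio i u < 1"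
proof -
  have pos: "0 < minor i u" "0 < minor (Suc i) u" "0 < cominor i u" "0 < cominor (Suc i) u"
    using i by (auto intro!: minors_pos)
  then show "0 < ratio i u" by (simp add: ratio_def)
  have "between_0_I i (sym_mat_of i u)"
    using between i by (simp add: between_0_I_iff_minors_pos)
  then obtain B Q where Q: "pos_def_mat i Q"
    and m: "minor (Suc i) u = minor i u * (u (i, i) - qform B (vec i (\<lambda>k. u (k, i))))"
    and c: "cominor (Suc i) u = cominor i u *
       (1 - u (i, i) - (qform Q (vec i (\<lambda>k. u (k, i))) - qform B (vec i (\<lambda>k. u (k, i)))))"
    by (rule minors_Suc) blast
  have "0 < 1 - u (i, i) - (qform Q (vec i (\<lambda>k. u (k, i))) - qform B (vec i (\<lambda>k. u (k, i))))"
    using pos unfolding c by (simp add: zero_less_mult_iff)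
  moreover have "0 \<le> qform Q (vec i (\<lambda>k. u (k, i)))"
    by (rule pos_def_mat_qform_nonneg[OF Q]) simp
  moreover have "ratio i u = u (i, i) - qform B (vec i (\<lambda>k. u (k, i)))"
    using pos by (simp add: ratio_def m)
  ultimately show "ratio i u < 1" by linarith
qed

lemma coratio_pos: "i < p \<Longrightarrow> 0 < coratio i u"
  using minors_pos[of "Suc i"] minors_pos[of i] ratio_bounds[of i] by (simp add: coratio_def)

lemma minor_prod_ratio: "j \<le> p \<Longrightarrow> minor j u = (\<Prod>i = 0..<j. ratio i u)"
proof (induction j)
  case (Suc j)
  have "minor (Suc j) u = minor j u * ratio j u"
    using minors_pos(1)[of j] Suc.prems by (simp add: ratio_def[of j])
  with Suc show ?case by simp
qed simp

text \<open>Both minors telescope: one step multiplies \<open>minor\<close> by s and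
  \<open>cominor\<close> by (1 - s) q. All factors are positive here, which makes \<open>ln\<close>
  additive over them. Order 1 has no factor q, hence the separate first term.\<close>

lemma ln_minors:
  assumes "1 \<le> j" "j \<le> p"
  shows "ln (minor j u powr a * cominor j u powr b) =
    ln (ratio 0 u powr a * (1 - ratio 0 u) powr b) +
    (\<Sum>i = 1..<j. ln (ratio i u powr a * (1 - ratio i u) powr b) + ln (coratio i u powr b))"
  using assms
proof (induction j rule: dec_induct)
  case base
  show ?case by (simp add: ratio_def minor_1 cominor_1)
next
  case (step j)
  have pos: "0 < minor j u" "0 < cominor j u" using step.prems by (auto intro!: minors_pos)
  have r: "0 < ratio j u" "0 < 1 - ratio j u" "0 < coratio j u"
    using step.prems ratio_bounds[of j] coratio_pos[of j] by auto
  have "minor (Suc j) u = minor j u * ratio j u"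
    and "cominor (Suc j) u = cominor j u * (1 - ratio j u) * coratio j u"
    using pos r by (simp_all add: ratio_def[of j] coratio_def)
  moreover have "ln ((x * y) powr a * (x' * y' * z) powr b) =
      ln (x powr a * x' powr b) + (ln (y powr a * y' powr b) + ln (z powr b))"
    if "0 < x" "0 < y" "0 < x'" "0 < y'" "0 < z" for x y x' y' z :: real
    using that by (simp add: ln_mult ln_powr distrib_left)
  ultimately have "ln (minor (Suc j) u powr a * cominor (Suc j) u powr b) =
      ln (minor j u powr a * cominor j u powr b) +
      (ln (ratio j u powr a * (1 - ratio j u) powr b) + ln (coratio j u powr b))"
    using pos r by presburger
  then show ?case using step by (simp add: sum.atLeastLessThan_Suc)
qed

end

theorem theorem3p2:
  fixes N :: "'a measure" and M :: "'a \<Rightarrow> real mat" and p :: nat and \<gamma> \<delta> :: real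
  assumes "prob_space N"
    and "p \<ge> 1"
    and "\<gamma> > (real p - 1) / 2"
    and "\<delta> > (real p - 1) / 2"
    and "JbetaE_distributed N p \<gamma> \<delta> M"
  shows "(AE \<omega> in N. between_0_I p (M \<omega>)) \<and>
    (\<exists>P :: nat \<Rightarrow> nat \<Rightarrow> 'a \<Rightarrow> real.
      prob_space.indep_vars N (\<lambda>_. borel) (\<lambda>(i, k). P i k)
        ({0..<p} \<times> {1} \<union> {1..<p} \<times> {2}) \<and>
      (\<forall>i\<in>{0..<p}. beta_distributed N (\<gamma> - real i / 2) \<delta> (P i 1)) \<and>
      (\<forall>i\<in>{1..<p}. beta_distributed N (\<delta> - real i / 2) (real i / 2) (P i 2)) \<and>
      (\<forall>\<omega>\<in>space N. between_0_I p (M \<omega>) \<longrightarrow>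
        (\<forall>i\<in>{0..<p}. 0 < P i 1 \<omega> \<and> P i 1 \<omega> < 1) \<and>
        (\<forall>i\<in>{1..<p}. 0 < P i 2 \<omega>) \<and>
        (\<forall>a b :: real. \<forall>j\<in>{1..p}.
          ln (det (upper_left (M \<omega>) j) powr a * det (1\<^sub>m j - upper_left (M \<omega>) j) powr b) =
          ln (P 0 1 \<omega> powr a * (1 - P 0 1 \<omega>) powr b) +
          (\<Sum>i = 1..<j. ln (P i 1 \<omega> powr a * (1 - P i 1 \<omega>) powr b) + ln (P i 2 \<omega> powr b))) \<and>
        det (M \<omega>) = (\<Prod>i = 0..<p. P i 1 \<omega>)))"
proof -
  interpret prob_space N by fact
  define X where "X \<omega> = upper_entries p (M \<omega>)" for \<omega>
  define K where "K u = JbetaE_kernel p \<gamma> \<delta> (sym_mat_of p u)" for u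
  have sym: "symmetric_mat p (M \<omega>)" if "\<omega> \<in> space N" for \<omega>
    using assms(5) that by (simp add: JbetaE_distributed_def)
  obtain c where c: "0 < c" and dist: "distributed N (upper_lborel p) X (\<lambda>u. ennreal (c * K u))"
    using assms(5) unfolding JbetaE_distributed_def X_def K_def by blast
  have X: "X \<in> measurable N (upper_lborel p)" by (rule distributed_measurable[OF dist])
  have K[measurable]: "K \<in> borel_measurable (upper_lborel p)"
    unfolding K_def by (rule measurable_JbetaE_kernel)
  have K0: "0 \<le> K u" for u by (simp add: K_def JbetaE_kernel_minors)
  have M: "M \<omega> = sym_mat_of p (X \<omega>)" if "\<omega> \<in> space N" for \<omega>
    using sym_mat_of_upper_entries[OF sym[OF that]] by (simp add: X_def)
  have dm: "(\<lambda>u. ennreal (c * K u)) \<in> borel_measurable (upper_lborel p)" by measurable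
  \<comment> \<open>The density vanishes off the event, so the law of the entries gives its
    complement no mass.\<close>
  have "AE u in distr N (upper_lborel p) X. between_0_I p (sym_mat_of p u)"
    unfolding distributed_distr_eq_density[OF dist] AE_density[OF dm]
    by (auto simp: K_def JbetaE_kernel_def intro!: AE_I2)
  from AE_distrD[OF X this] have AE: "AE \<omega> in N. between_0_I p (M \<omega>)"
    using AE_space by eventually_elim (simp add: M)
  \<comment> \<open>The coordinates are defined on the whole space; off the event the quotients are
    mere conventions, and the pointwise claims are restricted to it.\<close>
  define P :: "nat \<Rightarrow> nat \<Rightarrow> 'a \<Rightarrow> real"
    where "P i k \<omega> = (if k = 1 then ratio i (X \<omega>) else coratio i (X \<omega>))" for i k \<omega>
  define d where "d j = (if snd j = 1 then beta_density (\<gamma> - fst j / 2) \<delta>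
    else beta_density (\<delta> - fst j / 2) (fst j / 2))" for j :: "nat \<times> nat"
  define \<nu> where "\<nu> j = density lborel (\<lambda>x. ennreal (d j x))" for j
  define J :: "(nat \<times> nat) set" where "J = {0..<p} \<times> {1} \<union> {1..<p} \<times> {2}"
  have [measurable]: "d j \<in> borel_measurable borel" for j by (simp add: d_def)
  \<comment> \<open>The bounds on \<gamma> and \<delta> are what keeps these parameters positive up
    to i = p - 1.\<close>
  have pos1: "0 < \<gamma> - real i / 2" "0 < \<delta> - real i / 2" if "i < p" for i
  proof -
    have "real i \<le> real p - 1" using that by linarith
    then show "0 < \<gamma> - real i / 2" "0 < \<delta> - real i / 2" using assms(3,4) by (simp_all add: field_simps)
  qed
  have \<delta>: "0 < \<delta>" using pos1(2)[of 0] assms(2) by simp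
  have d1: "(\<integral>\<^sup>+x. ennreal (d j x) \<partial>lborel) = 1" if "j \<in> J" for j
    using that \<delta> pos1 by (auto simp: d_def J_def intro!: nn_integral_beta_density)
  obtain C where "0 < C" and C: "\<And>f g. (\<forall>i. f i \<in> borel_measurable borel) \<Longrightarrow> (\<forall>i. g i \<in> borel_measurable borel) \<Longrightarrow>
    (\<integral>\<^sup>+u. coord_prod p f g u * ennreal (K u) \<partial>upper_lborel p) =
    ennreal C * ((\<Prod>i<p. \<integral>\<^sup>+x. f i x * ennreal (beta_kernel (\<gamma> - i / 2) \<delta> x) \<partial>lborel) *
      (\<Prod>i\<in>{1..<p}. \<integral>\<^sup>+x. g i x * ennreal (beta_kernel (\<delta> - i / 2) (i / 2) x) \<partial>lborel))"
    using nn_integral_coord_prod[OF assms(2), of \<gamma> \<delta>] unfolding K_def by blast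
  \<comment> \<open>All constants at once: that of the given density, that of the factorization, and
    the Beta values that turn kernels into densities.\<close>
  define Z where "Z = ennreal c * (ennreal C * ((\<Prod>i<p. ennreal (Beta (\<gamma> - i / 2) \<delta>)) *
    (\<Prod>i\<in>{1..<p}. ennreal (Beta (\<delta> - i / 2) (i / 2)))))"
  have law: "(\<integral>\<^sup>+\<omega>. coord_prod p f g (X \<omega>) \<partial>N) =
      Z * ((\<Prod>i<p. \<integral>\<^sup>+x. f i x * ennreal (d (i, 1) x) \<partial>lborel) *
        (\<Prod>i\<in>{1..<p}. \<integral>\<^sup>+x. g i x * ennreal (d (i, 2) x) \<partial>lborel))"
    if f: "\<And>i. f i \<in> borel_measurable borel" and g: "\<And>i. g i \<in> borel_measurable borel" for f g
  proof -
    note [measurable] = measurable_coord_prod[OF f g, of p]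
    have "(\<integral>\<^sup>+\<omega>. coord_prod p f g (X \<omega>) \<partial>N) = (\<integral>\<^sup>+u. ennreal (c * K u) * coord_prod p f g u \<partial>upper_lborel p)"
      by (rule distributed_nn_integral[OF dist, symmetric]) measurable
    also have "\<dots> = (\<integral>\<^sup>+u. ennreal c * (coord_prod p f g u * ennreal (K u)) \<partial>upper_lborel p)"
      using c by (simp add: ennreal_mult' mult_ac)
    also have "\<dots> = ennreal c * (\<integral>\<^sup>+u. coord_prod p f g u * ennreal (K u) \<partial>upper_lborel p)"
      by (rule nn_integral_cmult) measurable
    also have "(\<integral>\<^sup>+u. coord_prod p f g u * ennreal (K u) \<partial>upper_lborel p) =
        ennreal C * ((\<Prod>i<p. ennreal (Beta (\<gamma> - i / 2) \<delta>) * (\<integral>\<^sup>+x. f i x * ennreal (d (i, 1) x) \<partial>lborel)) *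
        (\<Prod>i\<in>{1..<p}. ennreal (Beta (\<delta> - i / 2) (i / 2)) * (\<integral>\<^sup>+x. g i x * ennreal (d (i, 2) x) \<partial>lborel)))"
    proof -
      have "(\<integral>\<^sup>+x. f i x * ennreal (beta_kernel (\<gamma> - i / 2) \<delta> x) \<partial>lborel) =
          ennreal (Beta (\<gamma> - i / 2) \<delta>) * (\<integral>\<^sup>+x. f i x * ennreal (d (i, 1) x) \<partial>lborel)" if "i < p" for i
        using pos1(1)[OF that] \<delta> f by (simp add: nn_integral_beta_kernel d_def)
      moreover have "(\<integral>\<^sup>+x. g i x * ennreal (beta_kernel (\<delta> - i / 2) (i / 2) x) \<partial>lborel) =
          ennreal (Beta (\<delta> - i / 2) (i / 2)) * (\<integral>\<^sup>+x. g i x * ennreal (d (i, 2) x) \<partial>lborel)"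
        if "i \<in> {1..<p}" for i
        using pos1(2)[of i] that g by (simp add: nn_integral_beta_kernel d_def)
      ultimately show ?thesis using f g by (subst C) simp_all
    qed
    finally show ?thesis by (simp add: Z_def prod.distrib mult_ac)
  qed
  \<comment> \<open>With all test functions equal to 1, the left side of \<open>law\<close> is the
    total mass of N and every Beta density integrates to 1, so Z is determined without evaluating
    its factors.\<close>
  have "Z = 1"
  proof -
    have "(\<integral>\<^sup>+\<omega>. coord_prod p (\<lambda>_ _. 1) (\<lambda>_ _. 1) (X \<omega>) \<partial>N) = 1"
      by (simp add: coord_prod_def emeasure_space_1)
    moreover have "(\<integral>\<^sup>+x. 1 * ennreal (d (i, 1) x) \<partial>lborel) = 1" if "i < p" for i
      using d1[of "(i, 1)"] that by (simp add: J_def)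
    moreover have "(\<integral>\<^sup>+x. 1 * ennreal (d (i, 2) x) \<partial>lborel) = 1" if "i \<in> {1..<p}" for i
      using d1[of "(i, 2)"] that by (simp add: J_def)
    ultimately show ?thesis using law[of "\<lambda>_ _. 1" "\<lambda>_ _. 1"] by simp
  qed
  have P_eq: "P i 1 = (\<lambda>\<omega>. ratio i (X \<omega>))" "P i 2 = (\<lambda>\<omega>. coratio i (X \<omega>))" for i
    by (auto simp: P_def)
  have Pm: "case_prod P j \<in> borel_measurable N" if "j \<in> J" for j
    using that by (auto simp: J_def P_eq[simplified] intro!: measurable_compose[OF X] measurable_ratio)
  have \<nu>: "prob_space (\<nu> j)" if "j \<in> J" for j
    using d1[OF that] by (intro prob_spaceI) (simp add: \<nu>_def emeasure_density)
  \<comment> \<open>Indicators as test functions turn \<open>law\<close> into the probability of a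
    box.\<close>
  have rect: "(\<integral>\<^sup>+\<omega>. (\<Prod>j\<in>J. indicator (A j) (case_prod P j \<omega>)) \<partial>N) = (\<Prod>j\<in>J. emeasure (\<nu> j) (A j))"
    if A: "\<And>j. A j \<in> sets borel" for A
  proof -
    have "(\<Prod>j\<in>J. indicator (A j) (case_prod P j \<omega>)) =
        coord_prod p (\<lambda>i. indicator (A (i, 1))) (\<lambda>i. indicator (A (i, 2))) (X \<omega>)" for \<omega>
      unfolding J_def prod_coordinates by (simp add: coord_prod_def P_def)
    then have "(\<integral>\<^sup>+\<omega>. (\<Prod>j\<in>J. indicator (A j) (case_prod P j \<omega>)) \<partial>N) =
        (\<Prod>i<p. \<integral>\<^sup>+x. indicator (A (i, 1)) x * ennreal (d (i, 1) x) \<partial>lborel) *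
        (\<Prod>i\<in>{1..<p}. \<integral>\<^sup>+x. indicator (A (i, 2)) x * ennreal (d (i, 2) x) \<partial>lborel)"
      using law[of "\<lambda>i. indicator (A (i, 1))" "\<lambda>i. indicator (A (i, 2))"] A \<open>Z = 1\<close> by simp
    moreover have "emeasure (\<nu> j) (A j) = (\<integral>\<^sup>+x. indicator (A j) x * ennreal (d j x) \<partial>lborel)" for j
      using A by (simp add: \<nu>_def emeasure_density mult.commute)
    ultimately show ?thesis unfolding J_def prod_coordinates by simp
  qed
  have J: "finite J" "J \<noteq> {}" using assms(2) by (auto simp: J_def)
  have \<nu>s: "sets (\<nu> j) = sets borel" for j by (simp add: \<nu>_def)
  have indep: "indep_vars (\<lambda>_. borel) (case_prod P) J"
    by (rule indep_vars_of_product_law(1)[OF J Pm \<nu> \<nu>s rect])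
  have marginal: "distr N borel (case_prod P j) = \<nu> j" if "j \<in> J" for j
    by (rule indep_vars_of_product_law(2)[OF J Pm \<nu> \<nu>s rect that])
  have beta: "distributed N lborel (case_prod P j) (\<lambda>x. ennreal (d j x))" if "j \<in> J" for j
  proof -
    have "distr N lborel (case_prod P j) = distr N borel (case_prod P j)" by (intro distr_cong) auto
    then show ?thesis using marginal[OF that] Pm[OF that] by (simp add: distributed_def \<nu>_def)
  qed
  show ?thesis
  proof (intro conjI AE exI[of _ P] ballI impI allI)
    show "prob_space.indep_vars N (\<lambda>_. borel) (\<lambda>(i, k). P i k) ({0..<p} \<times> {1} \<union> {1..<p} \<times> {2})"
      using indep by (simp add: J_def)
    show "beta_distributed N (\<gamma> - real i / 2) \<delta> (P i 1)" if "i \<in> {0..<p}" for i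
      using beta[of "(i, 1)"] that by (simp add: beta_distributed_def d_def J_def)
    show "beta_distributed N (\<delta> - real i / 2) (real i / 2) (P i 2)" if "i \<in> {1..<p}" for i
      using beta[of "(i, 2)"] that by (simp add: beta_distributed_def d_def J_def)
    fix \<omega> assume \<omega>: "\<omega> \<in> space N" "between_0_I p (M \<omega>)"
    then have b: "between_0_I p (sym_mat_of p (X \<omega>))" by (simp add: M)
    show "0 < P i 1 \<omega>" "P i 1 \<omega> < 1" if "i \<in> {0..<p}" for i
      using ratio_bounds[OF b] that by (simp_all add: P_def)
    show "0 < P i 2 \<omega>" if "i \<in> {1..<p}" for i
      using coratio_pos[OF b] that by (simp add: P_def)
    show "det (M \<omega>) = (\<Prod>i = 0..<p. P i 1 \<omega>)"
      using minor_prod_ratio[OF b order_refl] by (simp add: P_def M[OF \<omega>(1)] minor_def)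
    fix a b' :: real and j assume j: "j \<in> {1..p}"
    then have "upper_left (M \<omega>) j = sym_mat_of j (X \<omega>)"
      by (simp add: X_def upper_left_sym_mat_of[OF sym[OF \<omega>(1)]])
    then show "ln (det (upper_left (M \<omega>) j) powr a * det (1\<^sub>m j - upper_left (M \<omega>) j) powr b') =
          ln (P 0 1 \<omega> powr a * (1 - P 0 1 \<omega>) powr b') +
          (\<Sum>i = 1..<j. ln (P i 1 \<omega> powr a * (1 - P i 1 \<omega>) powr b') + ln (P i 2 \<omega> powr b'))"
      using ln_minors[OF b, of j a b'] j by (simp add: P_def minor_def cominor_def)
  qed
qed

end
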